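(* Let $\mathcal{B}\subset\mathbb{R}^2$ be a (bounded) polygon. Then the no-slip billiard map $T:N\to N$ with table $\mathcal{B}$ is not ergodic with respect to the canonical invariant billiard measure $d\mu(q,v)=\langle v,e_3(q)\rangle\,dA_{\partial M}(q)\,dA(v)$ on $N$.
   Context: No-slip planar billiard. A disc of radius $R>0$ with rotationally symmetric mass distribution moves so that its center stays in a closed region $\mathcal{B}\subset\mathbb{R}^2$ (the billiard table) with piecewise smooth boundary. The mass distribution enters through a parameter $\gamma\in(0,1]$ (moment of inertia $=m(\gamma R)^2$, where $m$ is the mass), equivalently the characteristic angle $\beta\in(0,\pi/2]$ with $\gamma=\tan(\beta/2)$. The configuration manifold is $M=\mathcal{B}\times\mathbb{T}$, $\mathbb{T}=\mathbb{R}/(2\pi\gamma R\,\mathbb{Z})$, where the $\mathbb{T}$-coordinate is $x=\gamma R\theta$ and $\theta$ is the disc's angle of orientation; $\partial M=\partial\mathcal{B}\times\mathbb{T}$. Tangent spaces of $M$ are identified with $\mathbb{R}^3$ with the standard inner product. At $q\in\partial M$ lying over a smooth point of $\partial\mathcal{B}$, the product frame $(e_1,e_2(q),e_3(q))$ is the positively oriented orthonormal frame in which $e_1$ is the constant unit vector in the direction of $\mathbb{T}$, $e_2(q)$ is tangent to $\partial\mathcal{B}$, and $e_3(q)$ is the unit normal to $\partial M$ pointing into $M$. The no-slip collision map $C_q:\mathbb{R}^3\to\mathbb{R}^3$ is the linear map whose matrix in the product frame is $$\mathcal{C}=\begin{pmatrix}-\cos\beta&-\sin\beta&0\\-\sin\beta&\cos\beta&0\\0&0&-1\end{pmatrix}.$$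 The phase space is $N=\{(q,v): q\in\partial M,\ v\in\mathbb{R}^3,\ |v|=1,\ \langle v,e_3(q)\rangle>0\}$. The billiard map is $T(q,v)=(\tilde q,C_{\tilde q}v)$ with $\tilde q=q+tv$, $t=\inf\{s>0:q+sv\in\partial M\}$, defined on the (full measure) subset of $N$ where this makes sense and is smooth. $dA_{\partial M}$ is the area measure on $\partial M$ and $dA(v)$ is the area measure on the hemisphere $\{|v|=1,\langle v,e_3(q)\rangle>0\}$. The measure in the claim is $T$-invariant. *)

theory Defs
  imports "HOL-Analysis.Analysis" "HOL-Library.Real_Mod"
begin

unbundle no cross3_syntax

section \<open>Polygons\<close>

text \<open>A polygon is given by its vertices \<open>p 0, \<dots>, p (n - 1)\<close> in cyclic order.\<close>

definition side :: "nat \<Rightarrow> (nat \<Rightarrow> real^2) \<Rightarrow> nat \<Rightarrow> real \<Rightarrow> real^2" where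
  "side n p i = linepath (p i) (p (Suc i mod n))"

text \<open>Each side is taken without its terminal endpoint, so injectivity says exactly that the
  closed polygonal curve through the vertices has no self-intersection. Vertices with a straight
  angle are not excluded.\<close>

definition simple_polygon :: "nat \<Rightarrow> (nat \<Rightarrow> real^2) \<Rightarrow> bool" where
  "simple_polygon n p \<longleftrightarrow>
     n \<ge> 3 \<and> inj_on (\<lambda>(i, t). side n p i t) ({..<n} \<times> {0..<1})"

definition polygon_curve :: "nat \<Rightarrow> (nat \<Rightarrow> real^2) \<Rightarrow> (real^2) set" where
  "polygon_curve n p = (\<Union>i<n. path_image (side n p i))"

definition polygon_region :: "nat \<Rightarrow> (nat \<Rightarrow> real^2) \<Rightarrow> (real^2) set" where
  "polygon_region n p = polygon_curve n p \<union> inside (polygon_curve n p)"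

text \<open>Arc length on the polygonal curve: on each side it is the image of Lebesgue measure on
  \<open>[0, 1]\<close>, weighted by the length of the side, which is the constant speed of \<open>side n p i\<close>.\<close>

definition arc_length :: "nat \<Rightarrow> (nat \<Rightarrow> real^2) \<Rightarrow> (real^2) measure" where
  "arc_length n p =
     distr (density (count_space {..<n} \<Otimes>\<^sub>M restrict_space lborel {0..1})
              (\<lambda>(i, t). ennreal (dist (p i) (p (Suc i mod n)))))
       borel (\<lambda>(i, t). side n p i t)"


section \<open>Configuration manifold and product frame\<close>

text \<open>A configuration is a pair \<open>(y, x)\<close> of the position \<open>y\<close> of the center and the rotational
  coordinate \<open>x = \<gamma> R \<theta>\<close>. The circle \<open>\<real> / L\<int>\<close>, where \<open>L = 2 \<pi> \<gamma> R\<close>, is represented by its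
  fundamental domain \<open>[0, L)\<close>. Tangent vectors are elements of \<open>\<real>\<^sup>3\<close> whose first coordinate is the
  rotational one and whose other two are the planar ones; since \<open>(x, y\<^sub>1, y\<^sub>2)\<close> is a cyclic
  permutation of \<open>(y\<^sub>1, y\<^sub>2, x)\<close>, this does not affect the orientation.\<close>

type_synonym config = "(real^2) \<times> real"

definition planar_part :: "real^3 \<Rightarrow> real^2" where
  "planar_part v = vector [v$2, v$3]"

definition planar_vec :: "real^2 \<Rightarrow> real^3" where
  "planar_vec w = vector [0, w$1, w$2]"

definition boundary_M :: "real \<Rightarrow> (real^2) set \<Rightarrow> config set" where
  "boundary_M L B = frontier B \<times> {0..<L}"

text \<open>For tables with piecewise linear boundary, a boundary point is smooth if the table is a half
  plane near it.\<close>

definition is_inward_normal :: "(real^2) set \<Rightarrow> real^2 \<Rightarrow> real^2 \<Rightarrow> bool" where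
  "is_inward_normal B y \<nu> \<longleftrightarrow>
     norm \<nu> = 1 \<and> (\<exists>\<epsilon>>0. \<forall>z\<in>ball y \<epsilon>. z \<in> B \<longleftrightarrow> 0 \<le> (z - y) \<bullet> \<nu>)"

definition smooth_boundary :: "(real^2) set \<Rightarrow> (real^2) set" where
  "smooth_boundary B = {y \<in> frontier B. \<exists>\<nu>. is_inward_normal B y \<nu>}"

definition e1 :: "real^3" where
  "e1 = axis 1 1"

definition e3 :: "(real^2) set \<Rightarrow> config \<Rightarrow> real^3" where
  "e3 B q = planar_vec (THE \<nu>. is_inward_normal B (fst q) \<nu>)"

definition e2 :: "(real^2) set \<Rightarrow> config \<Rightarrow> real^3" where
  "e2 B q = cross3 (e3 B q) e1"


section \<open>The no-slip billiard map\<close>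

definition no_slip_matrix :: "real \<Rightarrow> real^3^3" where
  "no_slip_matrix \<beta> =
     vector [vector [- cos \<beta>, - sin \<beta>,   0],
             vector [- sin \<beta>,   cos \<beta>,   0],
             vector [0,         0,       - 1]]"

text \<open>The rows of \<open>F\<close> are the frame vectors, so \<open>F *v v\<close> are the frame coordinates of \<open>v\<close>.\<close>

definition collision_map :: "real \<Rightarrow> (real^2) set \<Rightarrow> config \<Rightarrow> real^3 \<Rightarrow> real^3" where
  "collision_map \<beta> B q v =
     (let F = (vector [e1, e2 B q, e3 B q] :: real^3^3)
      in transpose F *v (no_slip_matrix \<beta> *v (F *v v)))"

definition phase_space :: "real \<Rightarrow> (real^2) set \<Rightarrow> (config \<times> (real^3)) set" where
  "phase_space L B =
     {(q, v). q \<in> boundary_M L B \<and> fst q \<in> smooth_boundary B \<and> norm v = 1 \<and> v \<bullet> e3 B q > 0}"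

definition free_motion :: "real \<Rightarrow> config \<Rightarrow> real^3 \<Rightarrow> real \<Rightarrow> config" where
  "free_motion L q v s = (fst q + s *\<^sub>R planar_part v, (snd q + s * v$1) rmod L)"

definition hitting_times :: "real \<Rightarrow> (real^2) set \<Rightarrow> config \<Rightarrow> real^3 \<Rightarrow> real set" where
  "hitting_times L B q v = {s. s > 0 \<and> free_motion L q v s \<in> boundary_M L B}"

definition next_config :: "real \<Rightarrow> (real^2) set \<Rightarrow> config \<Rightarrow> real^3 \<Rightarrow> config" where
  "next_config L B q v = free_motion L q v (Inf (hitting_times L B q v))"

definition billiard_map ::
    "real \<Rightarrow> real \<Rightarrow> (real^2) set \<Rightarrow> config \<times> (real^3) \<Rightarrow> config \<times> (real^3)" where
  "billiard_map L \<beta> B =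
     (\<lambda>(q, v). (next_config L B q v, collision_map \<beta> B (next_config L B q v) v))"

text \<open>The points at which the billiard map is defined and smooth: the next collision takes place
  at a smooth boundary point and is transversal.\<close>

definition billiard_domain :: "real \<Rightarrow> (real^2) set \<Rightarrow> (config \<times> (real^3)) set" where
  "billiard_domain L B =
     {(q, v) \<in> phase_space L B.
        hitting_times L B q v \<noteq> {} \<and>
        fst (next_config L B q v) \<in> smooth_boundary B \<and>
        v \<bullet> e3 B (next_config L B q v) < 0}"


section \<open>The canonical billiard measure\<close>

text \<open>Area measure on the unit sphere, in spherical coordinates with polar angle \<open>\<phi>\<close> and azimuth
  \<open>\<theta>\<close>, for which the area element is \<open>sin \<phi> d\<phi> d\<theta>\<close>.\<close>

definition sphere_area :: "(real^3) measure" where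
  "sphere_area =
     distr (density (restrict_space lborel ({0..pi} \<times> {0..<2 * pi})) (\<lambda>(\<phi>, \<theta>). ennreal (sin \<phi>)))
       borel (\<lambda>(\<phi>, \<theta>). vector [sin \<phi> * cos \<theta>, sin \<phi> * sin \<theta>, cos \<phi>])"

definition boundary_area :: "real \<Rightarrow> nat \<Rightarrow> (nat \<Rightarrow> real^2) \<Rightarrow> config measure" where
  "boundary_area L n p = arc_length n p \<Otimes>\<^sub>M restrict_space lborel {0..<L}"

text \<open>The hemisphere of admissible velocities depends on the configuration; restricting the product
  measure to the phase space cuts it out of the sphere.\<close>

definition billiard_measure ::
    "real \<Rightarrow> nat \<Rightarrow> (nat \<Rightarrow> real^2) \<Rightarrow> (config \<times> (real^3)) measure" where
  "billiard_measure L n p =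
     density
       (restrict_space (boundary_area L n p \<Otimes>\<^sub>M sphere_area) (phase_space L (polygon_region n p)))
       (\<lambda>(q, v). ennreal (v \<bullet> e3 (polygon_region n p) q))"


section \<open>Ergodicity\<close>

text \<open>Ergodicity of a map \<open>T\<close> defined on a subset \<open>D\<close> of full measure: every measurable set that is
  invariant, \<open>T\<inverse>(A) = A\<close> on \<open>D\<close>, is null or conull. Invariance of the measure is not part of
  this predicate, so its negation asserts the existence of a nontrivial invariant set.\<close>

definition ergodic :: "'a measure \<Rightarrow> 'a set \<Rightarrow> ('a \<Rightarrow> 'a) \<Rightarrow> bool" where
  "ergodic M D T \<longleftrightarrow>
     (\<forall>A\<in>sets M. T -` A \<inter> D = A \<inter> D \<longrightarrow> emeasure M A = 0 \<or> emeasure M (space M - A) = 0)"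

end

theory Submission
  imports Defs
begin

text \<open>At a convex corner of the polygon, the collision maps at the two edges are half turns of \<open>\<real>\<^sup>3\<close>, and
  the unit vector \<open>w\<close> perpendicular to both axes is negated by each of them. Its planar part is normal to
  the bisector of the corner, so \<open>w\<close> gives rise to orbits of period two that bounce between the edges,
  arbitrarily close to the corner. For a velocity near \<open>w\<close>, collisions preserve the distance to
  \<open>\<plusminus>w\<close> because they are isometries, and the absolute value of the planar angular momentum about the
  corner is preserved by flights and collisions alike. Hence the distance to the corner stays
  controlled forever, and prescribing a range for the angular momentum yields invariant sets. Two disjoint
  ranges give two disjoint invariant sets of positive measure.\<close>

section \<open>Convex corners of polygons\<close>

text \<open>At a point of an edge the arm from the corner runs along that edge, so the planar
  angular momentum is the arm length times the normal velocity, up to sign. A no-slip collision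
  trades tangential velocity against spin but merely reverses the normal velocity; this is why the
  angular momentum survives although energy passes between translation and rotation. Closeness to
  \<open>w\<close> or \<open>- w\<close> keeps the normal velocity away from 0, and dividing by it
  turns a bound on the angular momentum into a bound on the arm. Convexity of the corner enters
  through the flights: a segment from one edge to the other runs through the interior of the sector,
  so no other collision intervenes. Since invariance is an equality of sets, preimages need the same
  control as images; a flight is therefore also traced backwards from its endpoint.\<close>

text \<open>The edges at the vertex \<open>P\<close> have directions \<open>a\<close> and \<open>b\<close>; \<open>\<nu>\<close> is the inward normal of the
  edge along \<open>a\<close> and \<open>\<mu>\<close> that of the edge along \<open>b\<close>.\<close>

locale corner =
  fixes B :: "(real^2) set" and P :: "real^2" and r :: real and a b \<nu> \<mu> :: "real^2"
  assumes radius_pos: "0 < r"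
    and norm_normal: "norm \<nu> = 1" "norm \<mu> = 1"
    and edge: "a \<bullet> \<nu> = 0" "b \<bullet> \<mu> = 0" "0 < a \<bullet> \<mu>" "0 < b \<bullet> \<nu>"
    and local_region: "z \<in> ball P r \<Longrightarrow> z \<in> B \<longleftrightarrow> 0 \<le> (z - P) \<bullet> \<nu> \<and> 0 \<le> (z - P) \<bullet> \<mu>"

section \<open>Linear algebra of two edge directions and their normals\<close>

lemma inner_vec2: "(x::real^2) \<bullet> y = x$1 * y$1 + x$2 * y$2"
  by (simp add: inner_vec_def sum_2)

lemma vec2_eq_iff: "(x::real^2) = y \<longleftrightarrow> x$1 = y$1 \<and> x$2 = y$2"
  by (simp add: vec_eq_iff forall_2)

text \<open>Cramer's rule: \<open>a\<close> is parallel to \<open>\<nu>\<close> turned by a right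
  angle, so \<open>a \<bullet> \<mu> \<noteq> 0\<close> says that the determinant \<open>d\<close>
  of the two normals does not vanish.\<close>

lemma orthogonal_basis_zero:
  fixes w \<nu> \<mu> a :: "real^2"
  assumes "w \<bullet> \<nu> = 0" "w \<bullet> \<mu> = 0" "a \<bullet> \<nu> = 0" "a \<bullet> \<mu> \<noteq> 0" "\<nu> \<noteq> 0"
  shows "w = 0"
proof -
  define d where "d = \<nu>$1 * \<mu>$2 - \<nu>$2 * \<mu>$1"
  have "a$1 * d = - (\<nu>$2) * (a \<bullet> \<mu>)" "a$2 * d = \<nu>$1 * (a \<bullet> \<mu>)"
    using assms(3) unfolding d_def inner_vec2 by algebra+
  then have "d \<noteq> 0"
    using assms(4,5) by (auto simp: vec2_eq_iff)
  moreover have "w$1 * d = 0" "w$2 * d = 0"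
    using assms(1,2) unfolding d_def inner_vec2 by algebra+
  ultimately show ?thesis
    by (simp add: vec2_eq_iff)
qed

text \<open>Up to scaling the normals form the basis dual to \<open>a\<close>, \<open>b\<close>, so
  coordinates are read off by inner products.\<close>

lemma decompose_dual:
  fixes x \<nu> \<mu> a b :: "real^2"
  assumes "a \<bullet> \<nu> = 0" "b \<bullet> \<mu> = 0" "a \<bullet> \<mu> \<noteq> 0" "b \<bullet> \<nu> \<noteq> 0"
  shows "x = ((x \<bullet> \<mu>) / (a \<bullet> \<mu>)) *\<^sub>R a + ((x \<bullet> \<nu>) / (b \<bullet> \<nu>)) *\<^sub>R b"
proof -
  have "\<nu> \<noteq> 0" using assms(4) by auto
  have "x - (((x \<bullet> \<mu>) / (a \<bullet> \<mu>)) *\<^sub>R a + ((x \<bullet> \<nu>) / (b \<bullet> \<nu>)) *\<^sub>R b) = 0"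
    by (rule orthogonal_basis_zero[where a = a and \<nu> = \<nu> and \<mu> = \<mu>])
      (use assms \<open>\<nu> \<noteq> 0\<close> in \<open>simp_all add: inner_diff_left inner_add_left\<close>)
  then show ?thesis by simp
qed

lemma obtain_dual_normals:
  fixes a b :: "real^2"
  assumes "a$1 * b$2 - a$2 * b$1 \<noteq> 0"
  obtains \<nu> \<mu> where "norm \<nu> = 1" "norm \<mu> = 1" "a \<bullet> \<nu> = 0" "b \<bullet> \<mu> = 0"
    "0 < a \<bullet> \<mu>" "0 < b \<bullet> \<nu>"
proof -
  define D where "D = a$1 * b$2 - a$2 * b$1"
  \<comment> \<open>The factor \<open>D\<close> turns both pairings into the square
    \<open>D * D\<close>, so the signs come out right for either orientation of \<open>a\<close>,
    \<open>b\<close>.\<close>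
  define na where "na = (D *\<^sub>R (vector [- (a$2), a$1] :: real^2))"
  define nb where "nb = (D *\<^sub>R (vector [b$2, - (b$1)] :: real^2))"
  have D: "D * D > 0" using assms not_real_square_gt_zero[of D] unfolding D_def by force
  have a: "a \<bullet> na = 0" "b \<bullet> na = D * D"
    by (simp_all add: inner_vec2 na_def D_def algebra_simps)
  have b: "b \<bullet> nb = 0" "a \<bullet> nb = D * D"
    by (simp_all add: inner_vec2 nb_def D_def algebra_simps)
  have "na \<noteq> 0" "nb \<noteq> 0" using a b D by auto
  then show thesis
    using a b D by (intro that[of "sgn na" "sgn nb"]) (simp_all add: norm_sgn sgn_div_norm)
qed

lemma side_0 [simp]: "side n p i 0 = p i"
  and side_1 [simp]: "side n p i 1 = p (Suc i mod n)"
  by (simp_all add: side_def linepath_def)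

lemma connected_subset_outside:
  assumes "connected U" "U \<inter> S = {}" "U \<inter> outside S \<noteq> {}"
  shows "U \<subseteq> outside S"
proof
  fix x assume "x \<in> U"
  obtain y where "y \<in> U" "y \<in> outside S" using assms by auto
  then show "x \<in> outside S"
    using \<open>x \<in> U\<close> assms by (intro outside_same_component[of S y x]) (auto simp: connected_component_def)
qed

lemma connected_subset_inside:
  assumes "connected U" "U \<inter> S = {}" "U \<inter> inside S \<noteq> {}"
  shows "U \<subseteq> inside S"
proof
  fix x assume "x \<in> U"
  obtain y where "y \<in> U" "y \<in> inside S" using assms by auto
  then show "x \<in> inside S"
    using \<open>x \<in> U\<close> assms by (intro inside_same_component[of S y x]) (auto simp: connected_component_def)
qed

text \<open>Expand the square of \<open>x - y\<close>. With \<open>y\<close> a vertex of maximal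
  norm and \<open>x\<close> another vertex, the vector \<open>x - y\<close> has negative product
  with \<open>y\<close>.\<close>

lemma inner_less_self:
  fixes x y :: "'a::real_inner"
  assumes "norm x \<le> norm y" "x \<noteq> y"
  shows "x \<bullet> y < y \<bullet> y"
proof -
  have "0 < (x - y) \<bullet> (x - y)" using assms(2) by simp
  moreover have "x \<bullet> x \<le> y \<bullet> y" using assms(1) by (simp add: norm_le)
  ultimately show ?thesis by (simp add: inner_diff inner_commute)
qed

lemma ray_Int_segment:
  fixes P Q :: "'a::real_normed_vector"
  assumes "0 \<le> s" "s * norm (Q - P) < norm (Q - P)"
  shows "P + s *\<^sub>R (Q - P) \<in> closed_segment P Q"
proof -
  have "s \<le> 1" using assms(2) by (metis less_eq_real_def linorder_not_less mult_left_le_one_le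
        mult_right_mono mult_1 norm_ge_zero)
  then show ?thesis
    using assms(1) by (auto simp: in_segment algebra_simps intro!: exI[of _ s])
qed

section \<open>Topology of a simple polygonal curve\<close>

context
  fixes n :: nat and p :: "nat \<Rightarrow> real^2"
  assumes polygon: "simple_polygon n p"
begin

lemma n_ge_3: "n \<ge> 3"
  using polygon by (simp add: simple_polygon_def)

lemma side_inj:
  assumes "side n p i s = side n p j t" "i < n" "j < n" "0 \<le> s" "s < 1" "0 \<le> t" "t < 1"
  shows "i = j \<and> s = t"
proof -
  have "inj_on (\<lambda>(i, t). side n p i t) ({..<n} \<times> {0..<1})"
    using polygon by (simp add: simple_polygon_def)
  from inj_onD[OF this, of "(i, s)" "(j, t)"] show ?thesis
    using assms by simp
qed

lemma vertex_inj:
  assumes "p i = p j" "i < n" "j < n"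
  shows "i = j"
  using side_inj[of i 0 j 0] assms by simp

lemma Suc_mod_ne: "i < n \<Longrightarrow> Suc i mod n \<noteq> i"
  using n_ge_3 by (cases "Suc i = n") auto

lemma Suc_mod_inj: "i < n \<Longrightarrow> j < n \<Longrightarrow> Suc i mod n = Suc j mod n \<Longrightarrow> i = j"
  using n_ge_3 by (metis Suc_inject Suc_lessI mod_less mod_self nat.distinct(1))

lemma arc_side: "i < n \<Longrightarrow> arc (side n p i)"
  unfolding side_def using vertex_inj[of i "Suc i mod n"] Suc_mod_ne[of i] n_ge_3
  by (intro arc_linepath) auto

text \<open>Injectivity is assumed only on half-open sides. A terminal endpoint is therefore
  rewritten as the initial point of the next side, which reduces all four cases to the
  assumption.\<close>

lemma path_image_side_Int:
  assumes "i < n" "j < n" "i \<noteq> j" "z \<in> path_image (side n p i)" "z \<in> path_image (side n p j)"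
  shows "(z = p i \<and> i = Suc j mod n) \<or> (z = p j \<and> j = Suc i mod n)"
proof -
  obtain s where s: "z = side n p i s" "0 \<le> s" "s \<le> 1"
    using assms(4) by (auto simp: path_image_def)
  obtain t where t: "z = side n p j t" "0 \<le> t" "t \<le> 1"
    using assms(5) by (auto simp: path_image_def)
  have i': "Suc i mod n < n" "Suc j mod n < n" using n_ge_3 by auto
  have *: "z = side n p (Suc i mod n) 0" if "s = 1" using that s by simp
  have **: "z = side n p (Suc j mod n) 0" if "t = 1" using that t by simp
  consider "s < 1" "t < 1" | "s = 1" "t < 1" | "s < 1" "t = 1" | "s = 1" "t = 1"
    using s t by linarith
  then show ?thesis
  proof cases
    case 1
    then show ?thesis using side_inj[of i s j t] assms s t by auto
  next
    case 2
    then have "Suc i mod n = j \<and> 0 = t"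
      using side_inj[of "Suc i mod n" 0 j t] assms i' * t by auto
    then show ?thesis using t by auto
  next
    case 3
    then have "Suc j mod n = i \<and> 0 = s"
      using side_inj[of "Suc j mod n" 0 i s] assms i' ** s by auto
    then show ?thesis using s by auto
  next
    case 4
    then have "Suc i mod n = Suc j mod n"
      using side_inj[of "Suc i mod n" 0 "Suc j mod n" 0] i' * ** by auto
    then show ?thesis using Suc_mod_inj assms by blast
  qed
qed

lemma arc_initial_sides:
  assumes "0 < k" "k < n"
  shows "\<exists>g. arc g \<and> pathstart g = p 0 \<and> pathfinish g = p k
    \<and> path_image g = (\<Union>i<k. path_image (side n p i))"
  using assms
proof (induction k rule: nat_induct_non_zero)
  case 1
  then show ?case
    using arc_side[of 0]
    by (intro exI[of _ "side n p 0"]) (auto simp: pathstart_def pathfinish_def lessThan_Suc)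
next
  case (Suc k)
  then obtain g where g: "arc g" "pathstart g = p 0" "pathfinish g = p k"
    "path_image g = (\<Union>i<k. path_image (side n p i))"
    by auto
  have k: "pathstart (side n p k) = p k" "pathfinish (side n p k) = p (Suc k)"
    using Suc by (simp_all add: pathstart_def pathfinish_def)
  have "path_image g \<inter> path_image (side n p k) \<subseteq> {p k}"
  proof safe
    fix z assume "z \<in> path_image g" "z \<in> path_image (side n p k)"
    then obtain i where i: "i < k" "z \<in> path_image (side n p i)" using g by auto
    \<comment> \<open>As \<open>Suc k < n\<close>, the index does not wrap around yet: the new side
      cannot end at the start of an earlier one.\<close>
    have "\<not> i = Suc k mod n" using i Suc by auto
    then show "z = p k"
      using path_image_side_Int[of i k z] i Suc \<open>z \<in> path_image (side n p k)\<close> by auto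
  qed
  then have "arc (g +++ side n p k)"
    using g k Suc by (intro arc_join arc_side) auto
  moreover have "path_image (g +++ side n p k) = (\<Union>i<Suc k. path_image (side n p i))"
    using g k by (subst path_image_join) (auto simp: lessThan_Suc)
  ultimately show ?case
    using g k by (intro exI[of _ "g +++ side n p k"]) auto
qed

lemma polygon_curve_homeomorphic_circle:
  "polygon_curve n p homeomorphic sphere (0::complex) 1"
proof -
  obtain k where k: "n = Suc k" "0 < k" using n_ge_3 by (cases n) auto
  obtain g where g: "arc g" "pathstart g = p 0" "pathfinish g = p k"
    "path_image g = (\<Union>i<k. path_image (side n p i))"
    using arc_initial_sides[of k] k by auto
  have s: "pathstart (side n p k) = p k" "pathfinish (side n p k) = p 0"
    using k by (simp_all add: pathstart_def pathfinish_def)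
  have "path_image g \<inter> path_image (side n p k) \<subseteq> {p 0, p k}"
  proof
    fix z assume z: "z \<in> path_image g \<inter> path_image (side n p k)"
    then obtain i where i: "i < k" "z \<in> path_image (side n p i)" using g by auto
    then show "z \<in> {p 0, p k}"
      using path_image_side_Int[of i k z] k z by auto
  qed
  moreover have "arc (side n p k)"
    using arc_side k by simp
  ultimately have "simple_path (g +++ side n p k)"
    by (intro simple_path_join_loop) (simp_all only: g s)
  moreover have "path_image (g +++ side n p k) = polygon_curve n p"
    using g s k by (subst path_image_join) (auto simp: polygon_curve_def lessThan_Suc)
  moreover have "pathfinish (g +++ side n p k) = pathstart (g +++ side n p k)"
    using g s by simp
  ultimately show ?thesis
    using homeomorphic_simple_path_image_circle[of "g +++ side n p k" 1 0] by simp
qed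

lemma compact_side: "compact (path_image (side n p i))"
  by (simp add: side_def)

lemma compact_polygon_curve: "compact (polygon_curve n p)"
  unfolding polygon_curve_def by (intro compact_UN compact_side) auto

text \<open>Since the outside is connected but the complement is not, the inside contains some
  component of the complement, and by Jordan-Brouwer the frontier of each component is the whole
  curve.\<close>

lemma inside_polygon_meets:
  assumes "z \<in> polygon_curve n p" "0 < r"
  shows "inside (polygon_curve n p) \<inter> ball z r \<noteq> {}"
proof -
  let ?C = "polygon_curve n p"
  have hom: "?C homeomorphic sphere (0::complex) 1"
    by (rule polygon_curve_homeomorphic_circle)
  \<comment> \<open>The separation theorem compares the curve with a sphere in its own ambient
    space.\<close>
  have "sphere (0::complex) 1 homeomorphic sphere (0::real^2) 1"
    by (rule homeomorphic_spheres_gen) auto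
  then have hom2: "?C homeomorphic sphere (0::real^2) 1"
    using hom homeomorphic_trans by blast
  have "\<not> connected (- ?C)"
    using Jordan_Brouwer_separation[OF hom2] by simp
  moreover have "connected (outside ?C)"
    using compact_polygon_curve by (intro connected_outside) (auto simp: compact_imp_bounded)
  ultimately have "inside ?C \<noteq> {}"
    by (metis inside_Un_outside sup_bot_left)
  then obtain x where x: "x \<in> inside ?C" by auto
  define T where "T = connected_component_set (- ?C) x"
  have xC: "x \<in> - ?C" using x inside_Un_outside by blast
  then have "T \<in> components (- ?C)"
    by (simp add: T_def componentsI)
  then have "frontier T = ?C"
    using Jordan_Brouwer_frontier[OF hom2] by simp
  then have "z \<in> closure T"
    using assms by (auto simp: frontier_def)
  then obtain y where "y \<in> T" "dist y z < r"
    using assms(2) closure_approachable by blast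
  moreover have "T \<subseteq> inside ?C"
    using x inside_same_component unfolding T_def by blast
  ultimately show ?thesis by (auto simp: dist_commute)
qed

lemma closed_path_image_side: "closed (path_image (side n p i))"
  by (simp add: side_def closed_segment)

lemma vertex_notin_side:
  assumes "i < n" "k < n" "k \<noteq> i" "Suc k mod n \<noteq> i"
  shows "p i \<notin> path_image (side n p k)"
proof
  assume "p i \<in> path_image (side n p k)"
  moreover have "p i \<in> path_image (side n p i)" by (simp add: side_def)
  ultimately have "p i = p k \<and> k = Suc i mod n"
    using path_image_side_Int[of i k "p i"] assms by auto
  then show False using vertex_inj[of i k] assms by auto
qed

text \<open>Two edges leaving \<open>p i\<close> in the same direction would overlap near
  \<open>p i\<close>.\<close>

lemma adjacent_edges_not_opposite:
  assumes ij: "i < n" "j < n" "Suc j mod n = i" "i \<noteq> j"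
    and k: "p j - p i = c *\<^sub>R (p (Suc i mod n) - p i)" "0 < c"
  shows False
proof -
  \<comment> \<open>A point before the far end of both edges; the side \<open>j\<close> runs towards
    \<open>p i\<close>, hence its parameter \<open>1 - t / c\<close> there.\<close>
  define t where "t = min 1 c / 2"
  have t: "0 < t" "t < 1" "t < c" using k(2) by (auto simp: t_def min_def)
  have "side n p i t = side n p j (1 - t / c)"
  proof -
    have "p i + (t / c) *\<^sub>R (p j - p i) = p i + t *\<^sub>R (p (Suc i mod n) - p i)"
      using k by simp
    then show ?thesis using ij(3) by (simp add: side_def linepath_def algebra_simps)
  qed
  then show False
    using side_inj[of i t j "1 - t / c"] ij t by (simp add: field_simps)
qed

text \<open>At a vertex of maximal norm the angle is less than \<open>\<pi>\<close>. Near it, each of the two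
  half discs making up the reflex side reaches beyond the disc about the origin that contains the
  polygon, hence lies outside; the convex sector must then be inside,
  since the inside accumulates at every point of the curve.\<close>

lemma convex_corner:
  obtains i r b \<nu> \<mu> where "i < n"
    "corner (polygon_region n p) (p i) r (p (Suc i mod n) - p i) b \<nu> \<mu>"
proof -
  let ?C = "polygon_curve n p"
  have n: "n \<ge> 3" by (rule n_ge_3)
  obtain i where i: "i < n" and max: "\<And>k. k < n \<Longrightarrow> norm (p k) \<le> norm (p i)"
  proof -
    have "finite ((\<lambda>k. norm (p k)) ` {..<n})" "(\<lambda>k. norm (p k)) ` {..<n} \<noteq> {}"
      using n by (auto simp: lessThan_empty_iff)
    from Max_in[OF this] Max_ge[OF this(1)] that show thesis by force
  qed
  obtain j where j: "j < n" "Suc j mod n = i"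
  proof (cases "i = 0")
    case True then show thesis using n by (intro that[of "n - 1"]) auto
  next
    case False then show thesis using i by (intro that[of "i - 1"]) auto
  qed
  have ji: "j \<noteq> i" using Suc_mod_ne[OF j(1)] j by auto
  define P where "P = p i"
  define a where "a = p (Suc i mod n) - P"
  define b where "b = p j - P"
  have i': "Suc i mod n < n" using n by auto
  have "p (Suc i mod n) \<noteq> P" "p j \<noteq> P"
    using vertex_inj[OF _ _ i] Suc_mod_ne[OF i] i' j ji by (auto simp: P_def)
  then have aP: "a \<bullet> P < 0" and bP: "b \<bullet> P < 0" and nz: "a \<noteq> 0" "b \<noteq> 0"
    using inner_less_self[of _ P] max[OF i'] max[OF j(1)]
    by (auto simp: a_def b_def P_def inner_diff_left)
  have indep: "a$1 * b$2 - a$2 * b$1 \<noteq> 0"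
  proof
    assume 0: "a$1 * b$2 - a$2 * b$1 = 0"
    \<comment> \<open>Parallel edges would differ by this factor. It is positive because both edges
      have negative product with \<open>P\<close>, so a straight angle is impossible and only the
      overlap remains to be excluded.\<close>
    define c where "c = (b \<bullet> P) / (a \<bullet> P)"
    have c: "0 < c" using aP bP by (simp add: c_def zero_less_divide_iff)
    have "(a \<bullet> P) *\<^sub>R b = (b \<bullet> P) *\<^sub>R a"
      using 0 unfolding vec2_eq_iff inner_vec2 by (simp, algebra)
    then have "b = c *\<^sub>R a"
      using aP by (simp add: c_def field_simps eq_vector_fraction_iff)
    then show False
      using adjacent_edges_not_opposite[OF i j(1,2) ji[symmetric], of c] c by (simp add: a_def b_def P_def)
  qed
  obtain \<nu> \<mu> where nu: "norm \<nu> = 1" "norm \<mu> = 1" "a \<bullet> \<nu> = 0" "b \<bullet> \<mu> = 0"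
    "0 < a \<bullet> \<mu>" "0 < b \<bullet> \<nu>"
    using obtain_dual_normals[OF indep] by metis
  define F where "F = (\<Union>k\<in>{..<n} - {i, j}. path_image (side n p k))"
  have "closed F" unfolding F_def by (auto intro!: closed_UN closed_path_image_side)
  moreover have "P \<notin> F"
    using vertex_notin_side[OF i] Suc_mod_inj[OF _ j(1)] j unfolding F_def P_def by blast
  ultimately obtain r0 where r0: "0 < r0" "ball P r0 \<subseteq> - F"
    using open_contains_ball[of "- F"] by (auto simp: open_Compl)
  \<comment> \<open>The ball avoids all other sides and ends before the far vertices, so within it
    the two edges look like full rays.\<close>
  define r where "r = min r0 (min (norm a) (norm b))"
  have r: "0 < r" "r \<le> r0" "r \<le> norm a" "r \<le> norm b"
    using r0 nz by (auto simp: r_def)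
  have curve: "?C = F \<union> path_image (side n p i) \<union> path_image (side n p j)"
    using i j by (auto simp: polygon_curve_def F_def)
  have side_i: "path_image (side n p i) = closed_segment P (P + a)"
    by (simp add: side_def P_def a_def)
  have side_j: "path_image (side n p j) = closed_segment P (P + b)"
    by (simp add: side_def P_def b_def j closed_segment_commute)
  have ray_a: "P + s *\<^sub>R a \<in> ?C" if "0 \<le> s" "P + s *\<^sub>R a \<in> ball P r" for s
    using that r ray_Int_segment[of s "P + a" P] by (auto simp: curve side_i dist_norm)
  have ray_b: "P + s *\<^sub>R b \<in> ?C" if "0 \<le> s" "P + s *\<^sub>R b \<in> ball P r" for s
    using that r ray_Int_segment[of s "P + b" P] by (auto simp: curve side_j dist_norm)
  have curve_rays: "\<exists>s\<ge>0. z = P + s *\<^sub>R a \<or> z = P + s *\<^sub>R b" if "z \<in> ?C" "z \<in> ball P r" for z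
  proof -
    have "z \<notin> F" using that r0 r subset_ball[of r r0 P] by blast
    then have "z \<in> closed_segment P (P + a) \<or> z \<in> closed_segment P (P + b)"
      using that by (auto simp: curve side_i side_j)
    then show ?thesis
      by (auto simp: in_segment algebra_simps)
  qed
  define W where "W = ball P r \<inter> {z. P \<bullet> \<nu> < z \<bullet> \<nu>} \<inter> {z. P \<bullet> \<mu> < z \<bullet> \<mu>}"
  define V where "V = (\<lambda>\<sigma>. ball P r \<inter> {z. z \<bullet> \<sigma> < P \<bullet> \<sigma>})"
  have halfspace: "convex {z. c < z \<bullet> d}" "convex {z. z \<bullet> d < c}" for c and d :: "real^2"
    using convex_halfspace_gt[of c d] convex_halfspace_lt[of d c] by (simp_all add: inner_commute)
  have conn: "connected W" "connected (V \<sigma>)" for \<sigma>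
    unfolding W_def V_def by (intro convex_connected convex_Int convex_ball halfspace)+
  have curve_ge: "P \<bullet> \<nu> \<le> z \<bullet> \<nu>" "P \<bullet> \<mu> \<le> z \<bullet> \<mu>" "z \<bullet> \<nu> = P \<bullet> \<nu> \<or> z \<bullet> \<mu> = P \<bullet> \<mu>"
    if "z \<in> ?C" "z \<in> ball P r" for z
    using curve_rays[OF that] nu by (auto simp: inner_add_left)
  have W_curve: "W \<inter> ?C = {}" and V_curve: "V \<nu> \<inter> ?C = {}" "V \<mu> \<inter> ?C = {}"
    using curve_ge by (force simp: W_def V_def)+
  have far_outside: "z \<in> outside ?C" if "norm P < norm z" for z
  proof -
    have "?C \<subseteq> cball 0 (norm P)"
    proof -
      have "closed_segment (p k) (p (Suc k mod n)) \<subseteq> cball 0 (norm P)" if "k < n" for k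
        using that max[of k] max[of "Suc k mod n"] n
        by (intro closed_segment_subset) (auto simp: P_def)
      then show ?thesis by (auto simp: polygon_curve_def side_def)
    qed
    then show ?thesis
      using outside_subset_convex[of "cball 0 (norm P)" ?C] that by auto
  qed
  have V_outside: "V \<sigma> \<subseteq> outside ?C"
    if V0: "V \<sigma> \<inter> ?C = {}" and x: "0 < x \<bullet> \<sigma>" "x \<bullet> P < 0" for x \<sigma>
  proof -
    \<comment> \<open>Step back from \<open>P\<close> against the edge direction \<open>x\<close>:
      by \<open>0 < x \<bullet> \<sigma>\<close> this enters the half disc, and by
      \<open>x \<bullet> P < 0\<close> the norm grows.\<close>
    define z where "z = P - (r / (2 * norm x)) *\<^sub>R x"
    have "x \<noteq> 0" using x by auto
    then have "z \<in> V \<sigma>"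
      using r x by (simp add: V_def z_def dist_norm inner_diff_left)
    moreover have "norm P < norm z"
    proof -
      define c where "c = r / (2 * norm x)"
      have "0 < c" using r \<open>x \<noteq> 0\<close> by (simp add: c_def)
      then have "c * (x \<bullet> P) < 0" "0 \<le> c * (c * (x \<bullet> x))"
        using x by (simp_all add: mult_pos_neg)
      moreover have "z \<bullet> z = P \<bullet> P - 2 * (c * (x \<bullet> P)) + c * (c * (x \<bullet> x))"
        unfolding z_def c_def[symmetric] by (simp add: inner_diff inner_commute algebra_simps)
      ultimately have "P \<bullet> P < z \<bullet> z" by linarith
      then show ?thesis by (simp add: norm_lt)
    qed
    ultimately show ?thesis
      using connected_subset_outside[OF conn(2) V0] far_outside by blast
  qed
  have outside: "V \<nu> \<subseteq> outside ?C" "V \<mu> \<subseteq> outside ?C"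
    using V_outside[OF V_curve(1) nu(6) bP] V_outside[OF V_curve(2) nu(5) aP] by auto
  \<comment> \<open>What is left of the ball has one vanishing and one nonnegative coordinate with
    respect to \<open>a\<close>, \<open>b\<close>, hence lies on an edge ray.\<close>
  have trichotomy: "z \<in> ?C" if z: "z \<in> ball P r" "z \<notin> W" "z \<notin> V \<nu>" "z \<notin> V \<mu>" for z
  proof -
    define s where "s = ((z - P) \<bullet> \<mu>) / (a \<bullet> \<mu>)"
    define t where "t = ((z - P) \<bullet> \<nu>) / (b \<bullet> \<nu>)"
    have ge: "0 \<le> (z - P) \<bullet> \<mu>" "0 \<le> (z - P) \<bullet> \<nu>" and "(z - P) \<bullet> \<mu> = 0 \<or> (z - P) \<bullet> \<nu> = 0"
      using z by (auto simp: W_def V_def inner_diff_left)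
    then have st: "0 \<le> s" "0 \<le> t" "s = 0 \<or> t = 0"
      using nu by (auto simp: s_def t_def)
    have "z - P = s *\<^sub>R a + t *\<^sub>R b"
      unfolding s_def t_def using nu by (intro decompose_dual) auto
    then have "z = P + s *\<^sub>R a \<or> z = P + t *\<^sub>R b"
      using st by (auto simp: algebra_simps)
    then show ?thesis using ray_a ray_b st z by metis
  qed
  have disj: "inside ?C \<inter> outside ?C = {}" "inside ?C \<inter> ?C = {}" "outside ?C \<inter> ?C = {}"
    by (auto simp: inside_Int_outside inside_no_overlap outside_no_overlap)
  have W_inside: "W \<subseteq> inside ?C"
  proof -
    have "P \<in> ?C" by (simp add: curve side_i)
    from inside_polygon_meets[OF this r(1)]
    obtain z where z: "z \<in> inside ?C" "z \<in> ball P r" by auto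
    then have "z \<in> W" using trichotomy[of z] outside disj by blast
    then show ?thesis
      using connected_subset_inside[OF conn(1) W_curve] z by blast
  qed
  have "corner (polygon_region n p) P r a b \<nu> \<mu>"
  proof
    fix z assume z: "z \<in> ball P r"
    have "z \<in> polygon_region n p \<longleftrightarrow> z \<notin> V \<nu> \<and> z \<notin> V \<mu>"
      unfolding polygon_region_def using W_inside outside disj trichotomy[OF z] by blast
    also have "\<dots> \<longleftrightarrow> 0 \<le> (z - P) \<bullet> \<nu> \<and> 0 \<le> (z - P) \<bullet> \<mu>"
      using z by (auto simp: V_def inner_diff_left)
    finally show "z \<in> polygon_region n p \<longleftrightarrow> 0 \<le> (z - P) \<bullet> \<nu> \<and> 0 \<le> (z - P) \<bullet> \<mu>" .
  qed (use r nu in auto)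
  then show thesis
    using that[OF i] by (simp add: P_def a_def)
qed

end

section \<open>Collisions at an edge\<close>

lemma inner_planar_vec: "v \<bullet> planar_vec \<nu> = planar_part v \<bullet> \<nu>"
  by (simp add: planar_vec_def planar_part_def inner_vec_def sum_3 sum_2)

lemma planar_part_uminus: "planar_part (- v) = - planar_part v"
  by (simp add: planar_part_def vec2_eq_iff)

lemma planar_part_diff: "planar_part (v - w) = planar_part v - planar_part w"
  by (simp add: planar_part_def vec2_eq_iff)

lemma inner_planar_part_le:
  assumes "norm \<nu> = 1"
  shows "\<bar>planar_part v \<bullet> \<nu>\<bar> \<le> norm v"
proof -
  have "norm (planar_vec \<nu>) = 1"
    using assms by (simp add: planar_vec_def norm_eq_1 inner_vec_def sum_3 sum_2)
  then show ?thesis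
    using Cauchy_Schwarz_ineq2[of v "planar_vec \<nu>"] by (simp add: inner_planar_vec)
qed

text \<open>Moving from \<open>y\<close> in the direction \<open>\<nu> - \<mu>\<close> cannot leave
  the half plane of \<open>\<nu>\<close> nor, unless the normals agree, stay in that of
  \<open>\<mu>\<close>. This gives the \<open>THE\<close> in \<open>e3\<close> its meaning.\<close>

lemma is_inward_normal_unique:
  assumes "is_inward_normal B y \<nu>" "is_inward_normal B y \<mu>"
  shows "\<nu> = \<mu>"
proof -
  obtain e where e: "0 < e" "\<And>z. z \<in> ball y e \<Longrightarrow> z \<in> B \<longleftrightarrow> 0 \<le> (z - y) \<bullet> \<nu>"
    using assms(1) by (auto simp: is_inward_normal_def)
  obtain d where d: "0 < d" "\<And>z. z \<in> ball y d \<Longrightarrow> z \<in> B \<longleftrightarrow> 0 \<le> (z - y) \<bullet> \<mu>"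
    using assms(2) by (auto simp: is_inward_normal_def)
  have n: "\<nu> \<bullet> \<nu> = 1" "\<mu> \<bullet> \<mu> = 1"
    using assms by (simp_all add: is_inward_normal_def norm_eq_1)
  have nm: "\<nu> \<bullet> \<mu> \<le> 1" using norm_cauchy_schwarz[of \<nu> \<mu>] assms by (simp add: is_inward_normal_def)
  \<comment> \<open>Since \<open>\<nu> - \<mu>\<close> has norm at most 2, the test point
    \<open>z\<close> lies in both balls.\<close>
  define k where "k = min e d / 4"
  define z where "z = y + k *\<^sub>R (\<nu> - \<mu>)"
  have "norm (\<nu> - \<mu>) \<le> 2"
    using norm_triangle_ineq4[of \<nu> \<mu>] assms by (simp add: is_inward_normal_def)
  then have "norm (k *\<^sub>R (\<nu> - \<mu>)) \<le> k * 2"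
    using e d by (simp add: k_def mult_left_mono del: min.bounded_iff min_less_iff_conj)
  also have "\<dots> < min e d" using e d by (auto simp: k_def)
  finally have "z \<in> ball y e" "z \<in> ball y d" by (simp_all add: z_def dist_norm)
  then have "0 \<le> (z - y) \<bullet> \<nu> \<longleftrightarrow> 0 \<le> (z - y) \<bullet> \<mu>" using e d by metis
  moreover have "0 < k" using e d by (simp add: k_def)
  ultimately have "\<nu> \<bullet> \<mu> = 1"
    using n nm by (auto simp: z_def inner_diff zero_le_mult_iff inner_commute)
  then have "(\<nu> - \<mu>) \<bullet> (\<nu> - \<mu>) = 0"
    using n by (simp add: inner_diff inner_commute)
  then show ?thesis by simp
qed

lemma is_inward_normal_frontier:
  assumes "is_inward_normal B y \<nu>"
  shows "y \<in> frontier B"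
proof -
  obtain e where e: "0 < e" "\<And>z. z \<in> ball y e \<Longrightarrow> z \<in> B \<longleftrightarrow> 0 \<le> (z - y) \<bullet> \<nu>"
    using assms(1) by (auto simp: is_inward_normal_def)
  have "y \<in> B" using e(2)[of y] e(1) by simp
  moreover have "y \<notin> interior B"
  proof
    assume "y \<in> interior B"
    then obtain d where d: "0 < d" "ball y d \<subseteq> B" by (auto simp: mem_interior)
    define k where "k = min e d / 2"
    have k: "0 < k" "k < e" "k < d" using e d by (auto simp: k_def)
    have n: "norm \<nu> = 1" using assms by (simp add: is_inward_normal_def)
    have "y - k *\<^sub>R \<nu> \<in> ball y e" "y - k *\<^sub>R \<nu> \<in> ball y d"
      using k n by (simp_all add: dist_norm)
    then have "0 \<le> (y - k *\<^sub>R \<nu> - y) \<bullet> \<nu>" using e d by blast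
    then show False using k n by (simp add: norm_eq_1)
  qed
  ultimately show ?thesis using closure_subset by (auto simp: frontier_def)
qed

lemma is_inward_normal_smooth: "is_inward_normal B y \<nu> \<Longrightarrow> y \<in> smooth_boundary B"
  using is_inward_normal_frontier by (auto simp: smooth_boundary_def)

lemma the_inward_normal: "is_inward_normal B y \<nu> \<Longrightarrow> (THE \<nu>. is_inward_normal B y \<nu>) = \<nu>"
  using is_inward_normal_unique by blast

lemma e3_eq: "is_inward_normal B y \<nu> \<Longrightarrow> e3 B (y, x) = planar_vec \<nu>"
  by (simp add: e3_def the_inward_normal)

lemma e2_eq: "is_inward_normal B y \<nu> \<Longrightarrow> e2 B (y, x) = vector [0, \<nu>$2, - \<nu>$1]"
  by (simp add: e2_def e3_eq cross3_def e1_def planar_vec_def axis_def)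

text \<open>Here \<open>t\<close> and \<open>m\<close> are the tangential and normal coordinates of
  the incoming velocity and \<open>t'\<close> is the outgoing tangential one.\<close>

lemma collision_map_eq:
  assumes "is_inward_normal B y \<nu>"
  shows "collision_map \<beta> B (y, x) v =
    (let t = v$2 * \<nu>$2 - v$3 * \<nu>$1; m = v$2 * \<nu>$1 + v$3 * \<nu>$2;
         t' = - sin \<beta> * v$1 + cos \<beta> * t
     in vector [- cos \<beta> * v$1 - sin \<beta> * t, t' * \<nu>$2 - m * \<nu>$1, - t' * \<nu>$1 - m * \<nu>$2])"
  unfolding collision_map_def Let_def e2_eq[OF assms] e3_eq[OF assms]
  by (simp add: vec_eq_iff forall_3 matrix_vector_mult_def sum_3 transpose_def no_slip_matrix_def
      e1_def axis_def planar_vec_def algebra_simps)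

lemma collision_map_diff:
  assumes "is_inward_normal B y \<nu>"
  shows "collision_map \<beta> B (y, x) (v - w) = collision_map \<beta> B (y, x) v - collision_map \<beta> B (y, x) w"
  unfolding collision_map_eq[OF assms] Let_def
  by (simp add: vec_eq_iff forall_3 algebra_simps)

lemma collision_map_uminus:
  assumes "is_inward_normal B y \<nu>"
  shows "collision_map \<beta> B (y, x) (- v) = - collision_map \<beta> B (y, x) v"
  unfolding collision_map_eq[OF assms] Let_def
  by (simp add: vec_eq_iff forall_3 algebra_simps)

lemma collision_map_scaleR:
  assumes "is_inward_normal B y \<nu>"
  shows "collision_map \<beta> B (y, x) (c *\<^sub>R v) = c *\<^sub>R collision_map \<beta> B (y, x) v"
  unfolding collision_map_eq[OF assms] Let_def
  by (simp add: vec_eq_iff forall_3 algebra_simps)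

lemma norm_collision_map:
  assumes "is_inward_normal B y \<nu>"
  shows "norm (collision_map \<beta> B (y, x) v) = norm v"
proof -
  have n: "\<nu>$1 * \<nu>$1 + \<nu>$2 * \<nu>$2 = 1"
    using assms by (simp add: is_inward_normal_def norm_eq_1 inner_vec2)
  have t: "sin \<beta> * sin \<beta> + cos \<beta> * cos \<beta> = 1"
    using sin_cos_squared_add[of \<beta>] by (simp add: power2_eq_square)
  show ?thesis
    unfolding norm_eq collision_map_eq[OF assms] Let_def
    by (simp add: inner_vec_def sum_3) (use n t in algebra)
qed

lemma collision_map_normal:
  assumes "is_inward_normal B y \<nu>"
  shows "planar_part (collision_map \<beta> B (y, x) v) \<bullet> \<nu> = - (planar_part v \<bullet> \<nu>)"
proof -
  have n: "\<nu>$1 * \<nu>$1 + \<nu>$2 * \<nu>$2 = 1"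
    using assms by (simp add: is_inward_normal_def norm_eq_1 inner_vec2)
  show ?thesis
    unfolding collision_map_eq[OF assms] Let_def planar_part_def inner_vec2
    by simp (use n in algebra)
qed

text \<open>The collision map at an edge is a half turn about an axis in the boundary plane. This is the
  common perpendicular of the two half-turn axes, which both half turns therefore negate; the factor
  \<open>sin \<beta> / (1 - cos \<beta>)\<close> is the inverse of \<open>\<gamma>\<close>.\<close>

definition corner_axis :: "real \<Rightarrow> real^2 \<Rightarrow> real^2 \<Rightarrow> real^3" where
  "corner_axis \<beta> \<nu> \<mu> = sgn (vector
     [sin \<beta> / (1 - cos \<beta>) * (\<nu>$1 * \<mu>$2 - \<nu>$2 * \<mu>$1), \<nu>$1 - \<mu>$1, \<nu>$2 - \<mu>$2])"

text \<open>By this antisymmetry the effect of a collision on the axis has to be computed for only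
  one of the two edges.\<close>

lemma corner_axis_swap: "corner_axis \<beta> \<mu> \<nu> = - corner_axis \<beta> \<nu> \<mu>"
proof -
  have *: "(vector [sin \<beta> / (1 - cos \<beta>) * (\<mu>$1 * \<nu>$2 - \<mu>$2 * \<nu>$1), \<mu>$1 - \<nu>$1, \<mu>$2 - \<nu>$2] :: real^3) =
    - vector [sin \<beta> / (1 - cos \<beta>) * (\<nu>$1 * \<mu>$2 - \<nu>$2 * \<mu>$1), \<nu>$1 - \<mu>$1, \<nu>$2 - \<mu>$2]"
    by (simp add: vec_eq_iff forall_3 algebra_simps)
  show ?thesis unfolding corner_axis_def * by (simp add: sgn_minus)
qed

text \<open>With \<open>k = sin \<beta> / (1 - cos \<beta>)\<close>, the pair \<open>(k, 1)\<close>
  is an eigenvector for \<open>- 1\<close> of the upper left 2x2 block of the collision matrix. The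
  first two frame coordinates of the unnormalized axis are \<open>d\<close> times this pair, and the
  third is negated anyway.\<close>

lemma collision_map_corner_axis:
  assumes "is_inward_normal B y \<nu>" and \<beta>: "cos \<beta> \<noteq> 1"
  shows "collision_map \<beta> B (y, x) (corner_axis \<beta> \<nu> \<mu>) = - corner_axis \<beta> \<nu> \<mu>"
proof -
  define k where "k = sin \<beta> / (1 - cos \<beta>)"
  have n: "\<nu>$1 * \<nu>$1 + \<nu>$2 * \<nu>$2 = 1"
    using assms by (simp add: is_inward_normal_def norm_eq_1 inner_vec2)
  have t: "sin \<beta> * sin \<beta> = (1 + cos \<beta>) * (1 - cos \<beta>)"
    using sin_cos_squared_add[of \<beta>] by (simp add: power2_eq_square algebra_simps)
  have k1: "k * (1 - cos \<beta>) = sin \<beta>" using \<beta> by (simp add: k_def)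
  have k2: "sin \<beta> * k = 1 + cos \<beta>" using \<beta> t by (simp add: k_def)
  define d where "d = \<nu>$1 * \<mu>$2 - \<nu>$2 * \<mu>$1"
  define u :: "real^3" where "u = vector [k * d, \<nu>$1 - \<mu>$1, \<nu>$2 - \<mu>$2]"
  have u: "corner_axis \<beta> \<nu> \<mu> = inverse (norm u) *\<^sub>R u"
    by (simp add: corner_axis_def u_def d_def k_def sgn_div_norm)
  have tangential: "u$2 * \<nu>$2 - u$3 * \<nu>$1 = d"
    by (simp add: u_def d_def algebra_simps)
  have kd1: "cos \<beta> * (k * d) + sin \<beta> * d = k * d"
    unfolding k1[symmetric] by (simp add: algebra_simps)
  have kd2: "cos \<beta> * d - sin \<beta> * (k * d) = - d"
    unfolding mult.assoc[symmetric] k2 by (simp add: algebra_simps)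
  have "collision_map \<beta> B (y, x) u = - u"
    unfolding collision_map_eq[OF assms(1)] Let_def tangential
  proof (simp add: vec_eq_iff forall_3, intro conjI)
    show "- (cos \<beta> * u$1) - sin \<beta> * d = - (u$1)"
      using kd1 by (simp add: u_def)
    have "- sin \<beta> * u$1 + cos \<beta> * d = - d"
      using kd2 by (simp add: u_def)
    then show "(cos \<beta> * d - sin \<beta> * u$1) * \<nu>$2 - (u$2 * \<nu>$1 + u$3 * \<nu>$2) * \<nu>$1 = - (u$2)"
      "(sin \<beta> * u$1 - cos \<beta> * d) * \<nu>$1 - (u$2 * \<nu>$1 + u$3 * \<nu>$2) * \<nu>$2 = - (u$3)"
      using n tangential by algebra+
  qed
  then show ?thesis
    by (simp add: u collision_map_scaleR[OF assms(1)])
qed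

lemma norm_corner_axis: "\<nu> \<noteq> \<mu> \<Longrightarrow> norm (corner_axis \<beta> \<nu> \<mu>) = 1"
  by (auto simp: corner_axis_def norm_sgn vec_eq_iff forall_3 forall_2)

text \<open>The planar part is a positive multiple of \<open>\<nu> - \<mu>\<close>. The opposite
  signs mean that motion along the axis leaves one edge and approaches the other, with the same
  normal speed \<open>h\<close> at both.\<close>

lemma corner_axis_normal:
  assumes "norm \<nu> = 1" "norm \<mu> = 1" "\<nu> \<noteq> \<mu>"
  obtains h where "0 < h" "planar_part (corner_axis \<beta> \<nu> \<mu>) \<bullet> \<nu> = h"
    "planar_part (corner_axis \<beta> \<nu> \<mu>) \<bullet> \<mu> = - h"
proof -
  let ?u = "vector [sin \<beta> / (1 - cos \<beta>) * (\<nu>$1 * \<mu>$2 - \<nu>$2 * \<mu>$1), \<nu>$1 - \<mu>$1, \<nu>$2 - \<mu>$2] :: real^3"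
  define c where "c = inverse (norm ?u)"
  have "?u \<noteq> 0" using assms(3) by (auto simp: vec_eq_iff forall_3 forall_2)
  then have c: "0 < c" by (simp add: c_def)
  have p: "planar_part (corner_axis \<beta> \<nu> \<mu>) = c *\<^sub>R (\<nu> - \<mu>)"
    by (simp add: corner_axis_def c_def sgn_div_norm planar_part_def vec2_eq_iff)
  have n: "\<nu> \<bullet> \<nu> = 1" "\<mu> \<bullet> \<mu> = 1" using assms by (simp_all add: norm_eq_1)
  have "0 < (\<nu> - \<mu>) \<bullet> (\<nu> - \<mu>)" using assms by simp
  then have "\<nu> \<bullet> \<mu> < 1" using n by (simp add: inner_diff inner_commute)
  then show thesis
    using c n by (intro that[of "c * (1 - \<nu> \<bullet> \<mu>)"]) (simp_all add: p inner_diff inner_commute algebra_simps)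
qed

section \<open>Trapped orbits in a convex corner\<close>

lemma corner_swap: "corner B P r a b \<nu> \<mu> \<Longrightarrow> corner B P r b a \<mu> \<nu>"
  by (auto simp: corner_def)

context corner
begin

lemma interior_region:
  assumes "z \<in> ball P r" "0 < (z - P) \<bullet> \<nu>" "0 < (z - P) \<bullet> \<mu>"
  shows "z \<in> interior B"
proof (rule interiorI)
  let ?U = "ball P r \<inter> {z. P \<bullet> \<nu> < z \<bullet> \<nu>} \<inter> {z. P \<bullet> \<mu> < z \<bullet> \<mu>}"
  show "open ?U"
    by (intro open_Int open_ball open_Collect_less continuous_intros)
  show "z \<in> ?U" using assms by (simp add: inner_diff_left)
  show "?U \<subseteq> B" using local_region by (force simp: inner_diff_left)
qed

lemma inward_normal_edge:
  assumes "z \<in> ball P r" "(z - P) \<bullet> \<nu> = 0" "0 < (z - P) \<bullet> \<mu>"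
  shows "is_inward_normal B z \<nu>"
proof -
  have "open (ball P r \<inter> {z. P \<bullet> \<mu> < z \<bullet> \<mu>})"
    by (intro open_Int open_ball open_Collect_less continuous_intros)
  moreover have "z \<in> ball P r \<inter> {z. P \<bullet> \<mu> < z \<bullet> \<mu>}"
    using assms by (simp add: inner_diff_left)
  ultimately obtain e where e: "0 < e" "ball z e \<subseteq> ball P r \<inter> {z. P \<bullet> \<mu> < z \<bullet> \<mu>}"
    by (meson open_contains_ball)
  have "x \<in> B \<longleftrightarrow> 0 \<le> (x - z) \<bullet> \<nu>" if "x \<in> ball z e" for x
  proof -
    have "x \<in> ball P r" "0 < (x - P) \<bullet> \<mu>" using that e by (auto simp: inner_diff_left)
    then show ?thesis using local_region[of x] assms(2) by (simp add: inner_diff_left)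
  qed
  then show ?thesis using e(1) norm_normal by (auto simp: is_inward_normal_def)
qed

text \<open>On the line of the edge \<open>a\<close>, the distance to \<open>P\<close> is
  proportional to the component along \<open>\<mu>\<close>.\<close>

lemma in_ball_edge:
  assumes "(y - P) \<bullet> \<nu> = 0" "0 \<le> (y - P) \<bullet> \<mu>" "(y - P) \<bullet> \<mu> * norm a < r * (a \<bullet> \<mu>)"
  shows "y \<in> ball P r"
proof -
  have "y - P = ((y - P) \<bullet> \<mu> / (a \<bullet> \<mu>)) *\<^sub>R a"
    using decompose_dual[of a \<nu> b \<mu> "y - P"] edge assms(1) by simp
  then have "norm (y - P) = (y - P) \<bullet> \<mu> / (a \<bullet> \<mu>) * norm a"
    using assms(2) edge by (metis abs_of_nonneg divide_nonneg_pos norm_scaleR)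
  also have "\<dots> < r" using assms(3) edge by (simp add: field_simps)
  finally show ?thesis by (simp add: dist_norm norm_minus_commute)
qed

text \<open>Each endpoint lies on one edge and strictly inside the half plane of the other, so
  proper convex combinations satisfy both inequalities strictly.\<close>

lemma flight_interior:
  assumes y: "y \<in> ball P r" "(y - P) \<bullet> \<nu> = 0" "0 < (y - P) \<bullet> \<mu>"
    and z: "y + t *\<^sub>R w \<in> ball P r" "(y + t *\<^sub>R w - P) \<bullet> \<mu> = 0" "0 < (y + t *\<^sub>R w - P) \<bullet> \<nu>"
    and s: "0 < s" "s < t"
  shows "y + s *\<^sub>R w \<in> interior B"
proof (rule interior_region)
  define k where "k = s / t"
  have k: "0 < k" "k < 1" "k * t = s" using s by (auto simp: k_def)
  have eq: "y + s *\<^sub>R w = (1 - k) *\<^sub>R y + k *\<^sub>R (y + t *\<^sub>R w)"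
    by (simp add: k(3)[symmetric] algebra_simps)
  show "y + s *\<^sub>R w \<in> ball P r"
    unfolding eq using k by (intro convexD convex_ball y z) auto
  have *: "(y + s *\<^sub>R w - P) = (1 - k) *\<^sub>R (y - P) + k *\<^sub>R (y + t *\<^sub>R w - P)"
    by (simp add: eq algebra_simps)
  show "0 < (y + s *\<^sub>R w - P) \<bullet> \<nu>" "0 < (y + s *\<^sub>R w - P) \<bullet> \<mu>"
    unfolding * inner_add_left inner_scaleR_left using y z k by simp_all
qed

end

text \<open>Up to a constant factor, the product \<open>(y - P) \<bullet> \<mu> * (planar_part v \<bullet> \<nu>)\<close> is the planar
  angular momentum about the corner. It is constant along the flight from one edge to the other, and a
  collision only changes its sign, which is absorbed by exchanging the roles of \<open>\<nu>\<close> and \<open>\<mu>\<close>.\<close>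

definition edge_trap ::
    "real^2 \<Rightarrow> real^2 \<Rightarrow> real^2 \<Rightarrow> real^3 \<Rightarrow> real \<Rightarrow> real \<Rightarrow> real \<Rightarrow> (config \<times> (real^3)) set" where
  "edge_trap P \<nu> \<mu> w \<eta> c1 c2 = {((y, x), v). (y - P) \<bullet> \<nu> = 0 \<and> 0 < (y - P) \<bullet> \<mu> \<and> norm (v - w) < \<eta> \<and>
     c1 < (y - P) \<bullet> \<mu> * (planar_part v \<bullet> \<nu>) \<and> (y - P) \<bullet> \<mu> * (planar_part v \<bullet> \<nu>) < c2}"

text \<open>The condition \<open>small\<close> is calibrated for velocities within
  \<open>h / 2\<close> of \<open>w\<close>: an angular momentum below \<open>c2\<close> and a normal
  speed above \<open>h / 2\<close> then force a distance to \<open>P\<close> below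
  \<open>r\<close>.\<close>

locale corner_trap = corner +
  fixes L \<beta> h c2 :: real and w :: "real^3"
  assumes L_pos: "0 < L"
    and h_pos: "0 < h"
    and axis_normal: "planar_part w \<bullet> \<nu> = h" "planar_part w \<bullet> \<mu> = - h"
    and collision_axis:
      "is_inward_normal B y \<nu> \<Longrightarrow> collision_map \<beta> B (y, x) w = - w"
      "is_inward_normal B y \<mu> \<Longrightarrow> collision_map \<beta> B (y, x) w = - w"
    and small: "2 * c2 * norm a \<le> r * h * (a \<bullet> \<mu>)" "2 * c2 * norm b \<le> r * h * (b \<bullet> \<nu>)"

text \<open>With this symmetry it suffices to study flights from the edge of \<open>\<nu>\<close> to
  that of \<open>\<mu>\<close>.\<close>

lemma corner_trap_swap:
  assumes "corner_trap B P r a b \<nu> \<mu> L \<beta> h c2 w"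
  shows "corner_trap B P r b a \<mu> \<nu> L \<beta> h c2 (- w)"
proof -
  interpret corner_trap B P r a b \<nu> \<mu> L \<beta> h c2 w by fact
  interpret swap: corner B P r b a \<mu> \<nu> by (rule corner_swap) unfold_locales
  show ?thesis
    by unfold_locales
      (use L_pos h_pos axis_normal collision_axis small in
        \<open>auto simp: planar_part_uminus collision_map_uminus\<close>)
qed

text \<open>Reduction modulo \<open>L\<close> always lands in \<open>{0..<L}\<close>, so hitting the
  boundary is a condition on the planar motion alone.\<close>

lemma hitting_times_eq:
  assumes "0 < L"
  shows "hitting_times L B (y, x) v = {s. 0 < s \<and> y + s *\<^sub>R planar_part v \<in> frontier B}"
  using assms by (auto simp: hitting_times_def free_motion_def boundary_M_def rmod_less rmod_nonneg)

context corner_trap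
begin

text \<open>The origin of the radius \<open>h / 2\<close>: normal components change by at most
  \<open>norm (v - w)\<close>, so at least half of the normal speed of \<open>w\<close> is kept,
  with its sign.\<close>

lemma near_axis:
  assumes "norm (v - w) < h / 2"
  shows "h / 2 < planar_part v \<bullet> \<nu>" "planar_part v \<bullet> \<mu> < - h / 2"
proof -
  have "\<bar>planar_part (v - w) \<bullet> \<nu>\<bar> < h / 2" "\<bar>planar_part (v - w) \<bullet> \<mu>\<bar> < h / 2"
    using inner_planar_part_le[OF norm_normal(1), of "v - w"]
      inner_planar_part_le[OF norm_normal(2), of "v - w"] assms by linarith+
  then show "h / 2 < planar_part v \<bullet> \<nu>" "planar_part v \<bullet> \<mu> < - h / 2"
    unfolding planar_part_diff inner_diff_left axis_normal by linarith+
qed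

text \<open>The number \<open>k\<close> stands for a normal speed at the edge. It is left abstract
  because at the far edge the relevant value is the outgoing speed, known before the collision as
  \<open>- (V \<bullet> \<mu>)\<close>.\<close>

lemma edge_trap_ball:
  assumes "(y - P) \<bullet> \<nu> = 0" "0 < (y - P) \<bullet> \<mu>" "h / 2 < k" "(y - P) \<bullet> \<mu> * k < c2"
  shows "y \<in> ball P r"
proof (rule in_ball_edge)
  have a: "0 < norm a" using edge by auto
  have "(y - P) \<bullet> \<mu> * (h / 2) \<le> (y - P) \<bullet> \<mu> * k"
    using assms by (intro mult_left_mono) auto
  then have "(y - P) \<bullet> \<mu> * (h / 2) < c2" using assms by linarith
  then have "(y - P) \<bullet> \<mu> * (h / 2) * norm a < c2 * norm a" using a by simp
  then have "h * ((y - P) \<bullet> \<mu> * norm a) < h * (r * (a \<bullet> \<mu>))" using small(1) by (simp add: algebra_simps)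
  then show "(y - P) \<bullet> \<mu> * norm a < r * (a \<bullet> \<mu>)" using h_pos by simp
qed (use assms in auto)

lemma inward_normal_frontier_edge:
  assumes "y \<in> ball P r" "(y - P) \<bullet> \<nu> = 0" "0 < (y - P) \<bullet> \<mu>"
  shows "is_inward_normal B y \<nu>" "y \<in> frontier B" "e3 B (y, x) = planar_vec \<nu>"
  using inward_normal_edge[OF assms] is_inward_normal_frontier e3_eq by auto

lemma forward:
  assumes "((y, x), v) \<in> edge_trap P \<nu> \<mu> w (h / 2) c1 c2"
  shows "billiard_map L \<beta> B ((y, x), v) \<in> edge_trap P \<mu> \<nu> (- w) (h / 2) c1 c2"
proof -
  interpret swap: corner_trap B P r b a \<mu> \<nu> L \<beta> h c2 "- w"
    by (rule corner_trap_swap) unfold_locales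
  define V where "V = planar_part v"
  have y: "(y - P) \<bullet> \<nu> = 0" "0 < (y - P) \<bullet> \<mu>" "norm (v - w) < h / 2"
    "c1 < (y - P) \<bullet> \<mu> * (V \<bullet> \<nu>)" "(y - P) \<bullet> \<mu> * (V \<bullet> \<nu>) < c2"
    using assms by (auto simp: edge_trap_def V_def)
  have V: "h / 2 < V \<bullet> \<nu>" "h / 2 < - (V \<bullet> \<mu>)"
    using near_axis[OF y(3)] by (auto simp: V_def)
  \<comment> \<open>The time at which the component along \<open>\<mu>\<close> is used up, that is,
    the arrival at the other edge.\<close>
  define t where "t = (y - P) \<bullet> \<mu> / - (V \<bullet> \<mu>)"
  have t: "0 < t" "t * - (V \<bullet> \<mu>) = (y - P) \<bullet> \<mu>"
    using y(2) V h_pos by (simp_all add: t_def divide_pos_neg)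
  define y' where "y' = y + t *\<^sub>R V"
  have y': "(y' - P) \<bullet> \<mu> = 0" "(y' - P) \<bullet> \<nu> = t * (V \<bullet> \<nu>)"
    using y(1) t(2) by (simp_all add: y'_def inner_diff_left inner_add_left)
  have pos: "0 < (y' - P) \<bullet> \<nu>" using y' t V h_pos by simp
  \<comment> \<open>Conservation of angular momentum along the flight: both sides equal
    \<open>t * (V \<bullet> \<nu>) * - (V \<bullet> \<mu>)\<close>.\<close>
  have I: "(y' - P) \<bullet> \<nu> * - (V \<bullet> \<mu>) = (y - P) \<bullet> \<mu> * (V \<bullet> \<nu>)"
    using y'(2) t(2) by (simp add: algebra_simps)
  have ball: "y \<in> ball P r" "y' \<in> ball P r"
    using edge_trap_ball[OF y(1,2) V(1) y(5)] swap.edge_trap_ball[OF y'(1) pos V(2)] I y(5) by auto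
  have edge': "is_inward_normal B y' \<mu>" "y' \<in> frontier B"
    using swap.inward_normal_frontier_edge[OF ball(2) y'(1) pos] by auto
  have "Inf (hitting_times L B (y, x) v) = t"
  proof (rule cInf_eq_minimum)
    show "t \<in> hitting_times L B (y, x) v"
      using t edge' by (simp add: hitting_times_eq[OF L_pos] y'_def V_def)
    fix s assume "s \<in> hitting_times L B (y, x) v"
    then have s: "0 < s" "y + s *\<^sub>R V \<notin> interior B"
      by (auto simp: hitting_times_eq[OF L_pos] V_def frontier_def)
    then show "t \<le> s"
      using flight_interior[OF ball(1) y(1,2), of t V s] ball(2) y'(1) pos
      by (force simp: y'_def)
  qed
  then obtain x' where map: "billiard_map L \<beta> B ((y, x), v) = ((y', x'), collision_map \<beta> B (y', x') v)"
    by (simp add: billiard_map_def next_config_def free_motion_def y'_def V_def)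
  define v' where "v' = collision_map \<beta> B (y', x') v"
  \<comment> \<open>As the collision maps \<open>w\<close> to \<open>- w\<close>, its linearity and
    isometry carry the distance from \<open>w\<close> over to \<open>- w\<close>.\<close>
  have "v' + w = collision_map \<beta> B (y', x') (v - w)"
    using collision_map_diff[OF edge'(1)] collision_axis(2)[OF edge'(1)] by (simp add: v'_def)
  then have "norm (v' - - w) < h / 2"
    using norm_collision_map[OF edge'(1)] y(3) by simp
  moreover have "planar_part v' \<bullet> \<mu> = - (V \<bullet> \<mu>)"
    using collision_map_normal[OF edge'(1)] by (simp add: v'_def V_def)
  ultimately show ?thesis
    unfolding map v'_def[symmetric] edge_trap_def using y'(1) pos I y(4,5) by simp
qed

text \<open>The collision at \<open>y'\<close> can be undone as far as the trap is concerned: the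
  distance to \<open>w\<close> and the normal speed before it are known. Following the line of
  flight back from \<open>y'\<close> reaches the edge of \<open>\<nu>\<close> at \<open>z\<close>,
  and the work lies in showing that the flight really started there.\<close>

lemma backward:
  assumes D: "((y, x), v) \<in> billiard_domain L B"
    and "billiard_map L \<beta> B ((y, x), v) \<in> edge_trap P \<mu> \<nu> (- w) (h / 2) c1 c2"
  shows "((y, x), v) \<in> edge_trap P \<nu> \<mu> w (h / 2) c1 c2"
proof -
  interpret swap: corner_trap B P r b a \<mu> \<nu> L \<beta> h c2 "- w"
    by (rule corner_trap_swap) unfold_locales
  define V where "V = planar_part v"
  define H where "H = hitting_times L B (y, x) v"
  define T where "T = Inf H"
  define y' where "y' = y + T *\<^sub>R V"
  define x' where "x' = (x + T * v$1) rmod L"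
  have next_eq: "next_config L B (y, x) v = (y', x')"
    by (simp add: next_config_def free_motion_def H_def T_def y'_def x'_def V_def)
  define v' where "v' = collision_map \<beta> B (y', x') v"
  have y': "(y' - P) \<bullet> \<mu> = 0" "0 < (y' - P) \<bullet> \<nu>" "norm (v' + w) < h / 2"
    "c1 < (y' - P) \<bullet> \<nu> * (planar_part v' \<bullet> \<mu>)" "(y' - P) \<bullet> \<nu> * (planar_part v' \<bullet> \<mu>) < c2"
    using assms(2) by (auto simp: edge_trap_def billiard_map_def next_eq v'_def)
  have "h / 2 < planar_part v' \<bullet> \<mu>"
    using swap.near_axis[of v'] y'(3) by simp
  from swap.edge_trap_ball[OF y'(1,2) this y'(5)] have ball': "y' \<in> ball P r" .
  have edge': "is_inward_normal B y' \<mu>"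
    using swap.inward_normal_edge[OF ball' y'(1,2)] .
  have "collision_map \<beta> B (y', x') (v - w) = v' + w"
    using collision_map_diff[OF edge'] collision_axis(2)[OF edge'] by (simp add: v'_def)
  then have v: "norm (v - w) < h / 2"
    using norm_collision_map[OF edge', of \<beta> x' "v - w"] y'(3) by simp
  have V\<mu>: "planar_part v' \<bullet> \<mu> = - (V \<bullet> \<mu>)"
    using collision_map_normal[OF edge'] by (simp add: v'_def V_def)
  have V: "h / 2 < V \<bullet> \<nu>" "h / 2 < - (V \<bullet> \<mu>)"
    using near_axis[OF v] by (auto simp: V_def)
  define t where "t = (y' - P) \<bullet> \<nu> / (V \<bullet> \<nu>)"
  have t: "0 < t" "t * (V \<bullet> \<nu>) = (y' - P) \<bullet> \<nu>"
    using y' V h_pos by (auto simp: t_def)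
  define z where "z = y' - t *\<^sub>R V"
  have z: "(z - P) \<bullet> \<nu> = 0" "(z - P) \<bullet> \<mu> = t * - (V \<bullet> \<mu>)"
    using y'(1) t(2) by (simp_all add: z_def inner_diff_left)
  have pos: "0 < (z - P) \<bullet> \<mu>" unfolding z(2) using t(1) V(2) h_pos by (intro mult_pos_pos) auto
  have I: "(z - P) \<bullet> \<mu> * (V \<bullet> \<nu>) = (y' - P) \<bullet> \<nu> * (planar_part v' \<bullet> \<mu>)"
    unfolding z(2) V\<mu> t(2)[symmetric] by simp
  have ball: "z \<in> ball P r"
    using edge_trap_ball[OF z(1) pos V(1)] I y'(5) by simp
  have z_front: "z \<in> frontier B"
    using inward_normal_frontier_edge[OF ball z(1) pos] by simp
  have ps: "((y, x), v) \<in> phase_space L B" "H \<noteq> {}"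
    using D by (auto simp: billiard_domain_def H_def)
  then have y_front: "y \<in> frontier B" "0 < v \<bullet> e3 B (y, x)"
    by (auto simp: phase_space_def boundary_M_def)
  have H_eq: "H = {s. 0 < s \<and> y + s *\<^sub>R V \<in> frontier B}"
    by (simp add: H_def hitting_times_eq[OF L_pos] V_def)
  have "0 \<le> T" unfolding T_def using ps(2) by (intro cInf_greatest) (auto simp: H_eq)
  \<comment> \<open>The infimum of positive hitting times could be 0. Then \<open>y\<close> would
    lie on the edge of \<open>\<mu>\<close>, where \<open>v\<close> points outward, against the
    definition of the phase space.\<close>
  moreover have "T \<noteq> 0"
  proof
    assume "T = 0"
    then have "0 < v \<bullet> planar_vec \<mu>"
      using y_front(2) e3_eq[OF edge'] by (simp add: y'_def)
    then show False using V h_pos by (simp add: inner_planar_vec V_def)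
  qed
  \<comment> \<open>A later start would lie strictly between the edges, hence in the
    interior.\<close>
  moreover have "\<not> T < t"
  proof
    assume "T < t"
    have "z + (t - T) *\<^sub>R V \<in> interior B"
      using flight_interior[OF ball z(1) pos, of t V "t - T"] ball' y' \<open>T < t\<close> \<open>0 \<le> T\<close> \<open>T \<noteq> 0\<close>
      by (simp add: z_def)
    then have "y \<in> interior B" by (simp add: z_def y'_def algebra_simps)
    then show False using y_front by (simp add: frontier_def)
  qed
  \<comment> \<open>An earlier start would give a collision at \<open>z\<close> before the time
    \<open>T\<close>.\<close>
  moreover have "\<not> t < T"
  proof
    assume "t < T"
    then have "T - t \<in> H" using z_front by (simp add: H_eq z_def y'_def algebra_simps)
    then have "T \<le> T - t" unfolding T_def by (intro cInf_lower bdd_belowI[of _ 0]) (auto simp: H_eq)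
    then show False using t by simp
  qed
  ultimately have "T = t" by simp
  then have "y = z" by (simp add: z_def y'_def)
  then show ?thesis
    using z(1) pos v I y'(4,5) by (simp add: edge_trap_def V_def)
qed

end

definition corner_trap_set ::
    "real^2 \<Rightarrow> real^2 \<Rightarrow> real^2 \<Rightarrow> real^3 \<Rightarrow> real \<Rightarrow> real \<Rightarrow> real \<Rightarrow> (config \<times> (real^3)) set" where
  "corner_trap_set P \<nu> \<mu> w \<eta> c1 c2 = edge_trap P \<nu> \<mu> w \<eta> c1 c2 \<union> edge_trap P \<mu> \<nu> (- w) \<eta> c1 c2"

lemma (in corner_trap) corner_trap_set_invariant:
  "billiard_map L \<beta> B -` corner_trap_set P \<nu> \<mu> w (h / 2) c1 c2 \<inter> billiard_domain L B
    = corner_trap_set P \<nu> \<mu> w (h / 2) c1 c2 \<inter> billiard_domain L B"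
proof -
  interpret swap: corner_trap B P r b a \<mu> \<nu> L \<beta> h c2 "- w"
    by (rule corner_trap_swap) unfold_locales
  show ?thesis
    using forward backward swap.forward swap.backward
    by (auto simp: corner_trap_set_def)
qed

section \<open>Positivity of the billiard measure\<close>

lemma vector_3_eq: "(vector [x, y, z] :: real^3) = x *\<^sub>R axis 1 1 + y *\<^sub>R axis 2 1 + z *\<^sub>R axis 3 1"
  by (simp add: vec_eq_iff forall_3 axis_def)

lemma vector_2_eq: "(vector [x, y] :: real^2) = x *\<^sub>R axis 1 1 + y *\<^sub>R axis 2 1"
  by (simp add: vec_eq_iff forall_2 axis_def)

lemma open_emeasure_lborel_pos:
  fixes U :: "'a::euclidean_space set"
  assumes "open U" "U \<noteq> {}"
  shows "0 < emeasure lborel U"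
proof -
  have "U \<notin> null_sets lebesgue"
    using open_not_negligible[OF assms] by (simp add: negligible_iff_null_sets)
  then show ?thesis
    using assms(1) by (auto simp: null_sets_def zero_less_iff_neq_zero)
qed

section \<open>Open sets have positive area on the sphere\<close>

definition spherical :: "real \<times> real \<Rightarrow> real^3" where
  "spherical = (\<lambda>(\<phi>, \<theta>). vector [sin \<phi> * cos \<theta>, sin \<phi> * sin \<theta>, cos \<phi>])"

lemma continuous_spherical: "continuous_on A spherical"
  unfolding spherical_def case_prod_beta vector_3_eq by (intro continuous_intros)

text \<open>The closed parameter box is used because it is the closure of the open box on which
  \<open>sin \<phi>\<close> is positive.\<close>

lemma spherical_surj:
  assumes "norm v = 1"
  obtains z where "z \<in> cbox (0, 0) (pi, 2 * pi)" "spherical z = v"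
proof -
  have v: "(v$1)\<^sup>2 + (v$2)\<^sup>2 + (v$3)\<^sup>2 = 1"
    using assms by (simp add: norm_eq_1 inner_vec_def sum_3 power2_eq_square)
  have "(v$3)\<^sup>2 \<le> 1" using v by (smt (verit) zero_le_power2)
  then have v3: "\<bar>v$3\<bar> \<le> 1" by (simp add: abs_square_le_1)
  define \<phi> where "\<phi> = arccos (v$3)"
  have \<phi>: "0 \<le> \<phi>" "\<phi> \<le> pi" "cos \<phi> = v$3"
    using v3 by (auto simp: \<phi>_def arccos_lbound arccos_ubound abs_le_iff)
  have s: "(sin \<phi>)\<^sup>2 = (v$1)\<^sup>2 + (v$2)\<^sup>2"
    using v sin_cos_squared_add[of \<phi>] by (simp add: \<phi>(3))
  obtain \<theta> where \<theta>: "0 \<le> \<theta>" "\<theta> \<le> 2 * pi" "sin \<phi> * cos \<theta> = v$1" "sin \<phi> * sin \<theta> = v$2"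
  proof (cases "sin \<phi> = 0")
    case True
    then have "v$1 = 0" "v$2 = 0" using s by (auto simp: sum_power2_eq_zero_iff)
    then show thesis using True that[of 0] by simp
  next
    case False
    then have "(v$1 / sin \<phi>)\<^sup>2 + (v$2 / sin \<phi>)\<^sup>2 = 1"
      by (simp add: power_divide s flip: add_divide_distrib) (use s False in force)
    then obtain \<theta> where "0 \<le> \<theta>" "\<theta> < 2 * pi" "v$1 / sin \<phi> = cos \<theta>" "v$2 / sin \<phi> = sin \<theta>"
      using sincos_total_2pi by metis
    then show thesis using that[of \<theta>] False by (simp add: field_simps)
  qed
  show thesis
    using that[of "(\<phi>, \<theta>)"] \<phi> \<theta> by (auto simp: spherical_def vec_eq_iff forall_3 cbox_Pair_eq)
qed

lemma sets_sphere_area [simp, measurable_cong]: "sets sphere_area = sets borel"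
  by (simp add: sphere_area_def)

lemma space_sphere_area [simp]: "space sphere_area = UNIV"
  by (simp add: sphere_area_def)

lemma spherical_measurable [measurable]: "spherical \<in> borel_measurable borel"
  by (intro borel_measurable_continuous_onI continuous_spherical)

lemma ennreal_sin_fst_measurable: "(\<lambda>z::real \<times> real. ennreal (sin (fst z))) \<in> borel_measurable borel"
  by (intro measurable_compose[OF _ measurable_ennreal] borel_measurable_continuous_onI continuous_intros)

lemma emeasure_sphere_area:
  assumes "A \<in> sets borel"
  shows "emeasure sphere_area A =
    (\<integral>\<^sup>+z. ennreal (sin (fst z)) * indicator (spherical -` A \<inter> {0..pi} \<times> {0..<2 * pi}) z \<partial>lborel)"
proof -
  let ?\<Omega> = "{0..pi} \<times> {0..<2 * pi}"
  let ?R = "restrict_space lborel ?\<Omega>"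
  have \<Omega>: "?\<Omega> \<in> sets borel" by (intro borel_Times) auto
  have A: "spherical -` A \<in> sets borel"
    using measurable_sets[OF spherical_measurable assms] by simp
  have sp: "(\<lambda>(\<phi>, \<theta>). vector [sin \<phi> * cos \<theta>, sin \<phi> * sin \<theta>, cos \<phi>]) = spherical"
    by (simp add: spherical_def)
  have dn: "(\<lambda>(\<phi>, \<theta>::real). ennreal (sin \<phi>)) = (\<lambda>z. ennreal (sin (fst z)))"
    by (auto simp: fun_eq_iff)
  have meas: "spherical \<in> measurable ?R borel"
    by (rule measurable_restrict_space1) simp
  have dens: "(\<lambda>z::real \<times> real. ennreal (sin (fst z))) \<in> borel_measurable lborel"
    using ennreal_sin_fst_measurable by simp
  have "emeasure sphere_area A = emeasure (density ?R (\<lambda>z. ennreal (sin (fst z)))) (spherical -` A \<inter> ?\<Omega>)"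
    unfolding sphere_area_def sp dn using meas assms
    by (subst emeasure_distr) (auto simp: space_restrict_space)
  also have "\<dots> = (\<integral>\<^sup>+z. ennreal (sin (fst z)) * indicator (spherical -` A \<inter> ?\<Omega>) z \<partial>?R)"
    using A \<Omega> dens
    by (subst emeasure_density) (auto intro: measurable_restrict_space1 simp: sets_restrict_space_iff)
  also have "\<dots> = (\<integral>\<^sup>+z. ennreal (sin (fst z)) * indicator (spherical -` A \<inter> ?\<Omega>) z \<partial>lborel)"
    using \<Omega> by (subst nn_integral_restrict_space) (auto intro!: nn_integral_cong simp: indicator_def)
  finally show ?thesis .
qed

lemma finite_measure_sphere_area: "finite_measure sphere_area"
proof (rule finite_measureI)
  let ?\<Omega> = "cbox (0::real, 0::real) (pi, 2 * pi)"
  have "emeasure sphere_area UNIV \<le> (\<integral>\<^sup>+z. indicator ?\<Omega> z \<partial>lborel)"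
    by (subst emeasure_sphere_area)
      (auto intro!: nn_integral_mono simp: indicator_def cbox_Pair_eq ennreal_le_1)
  also have "\<dots> < \<infinity>" using emeasure_lborel_cbox_finite[of "(0::real, 0::real)" "(pi, 2 * pi)"] by simp
  finally show "emeasure sphere_area (space sphere_area) \<noteq> \<infinity>" by simp
qed

text \<open>The point \<open>v\<close> may be a pole or lie on the seam of the azimuth. Its
  parameter is still in the closure of the open box, so the open preimage of \<open>U\<close> meets
  that box, where the density is positive.\<close>

lemma sphere_area_open_pos:
  assumes "open U" "v \<in> U" "norm v = 1"
  shows "0 < emeasure sphere_area (U \<inter> sphere 0 1)"
proof -
  let ?B = "{0<..<pi} \<times> {0<..<2 * pi}"
  obtain z where z: "z \<in> cbox (0, 0) (pi, 2 * pi)" "spherical z = v"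
    using spherical_surj[OF assms(3)] by blast
  define G where "G = spherical -` U \<inter> ?B"
  have op: "open (spherical -` U)" using assms(1) continuous_spherical by (rule open_vimage)
  have "open G" unfolding G_def using op by (intro open_Int open_Times) auto
  moreover have "G \<noteq> {}"
  proof -
    have "z \<in> closure ?B" using z by (auto simp: closure_Times cbox_Pair_eq)
    then show ?thesis using op z assms(2) open_Int_closure_eq_empty[OF op, of ?B]
      unfolding G_def by blast
  qed
  ultimately have pos: "0 < emeasure lborel G" by (rule open_emeasure_lborel_pos)
  have G_sets: "G \<in> sets borel" using \<open>open G\<close> by simp
  let ?f = "\<lambda>z. ennreal (sin (fst z)) *
    indicator (spherical -` (U \<inter> sphere 0 1) \<inter> {0..pi} \<times> {0..<2 * pi}) (z::real \<times> real)"
  have meas: "?f \<in> borel_measurable lborel"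
  proof -
    have "spherical -` (U \<inter> sphere 0 1) \<in> sets borel"
      using measurable_sets[OF spherical_measurable, of "U \<inter> sphere 0 1"] assms(1) by simp
    then have "spherical -` (U \<inter> sphere 0 1) \<inter> {0..pi} \<times> {0..<2 * pi} \<in> sets borel"
      by (intro sets.Int borel_Times) auto
    moreover have "(\<lambda>z::real \<times> real. ennreal (sin (fst z))) \<in> borel_measurable lborel"
      using ennreal_sin_fst_measurable by simp
    ultimately show ?thesis by (intro borel_measurable_times_ennreal borel_measurable_indicator) auto
  qed
  have "emeasure sphere_area (U \<inter> sphere 0 1) \<noteq> 0"
  proof
    assume "emeasure sphere_area (U \<inter> sphere 0 1) = 0"
    then have "AE z in lborel. ?f z = 0"
      using meas assms(1) by (simp add: emeasure_sphere_area nn_integral_0_iff_AE)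
    moreover have "?f z \<noteq> 0" if "z \<in> G" for z
    proof -
      have "0 < sin (fst z)" using that by (auto simp: G_def intro: sin_gt_zero)
      moreover have "norm (spherical z) = 1"
      proof -
        have "(sin \<phi> * cos \<theta>) * (sin \<phi> * cos \<theta>) + (sin \<phi> * sin \<theta>) * (sin \<phi> * sin \<theta>)
            + cos \<phi> * cos \<phi> = 1" for \<phi> \<theta> :: real
          using sin_cos_squared_add[of \<phi>] sin_cos_squared_add[of \<theta>] by algebra
        then show ?thesis
          by (simp add: norm_eq_1 spherical_def inner_vec_def sum_3 split: prod.split)
      qed
      ultimately show ?thesis
        using that by (auto simp: G_def)
    qed
    ultimately have "AE z in lborel. z \<notin> G" by (auto elim: eventually_mono)
    then have "G \<in> null_sets lborel"
      using G_sets by (subst (asm) AE_iff_null_sets[symmetric]) auto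
    then show False using pos by (simp add: null_sets_def)
  qed
  then show ?thesis by (simp add: zero_less_iff_neq_zero)
qed

section \<open>Open pieces of a side have positive length\<close>

lemma sets_arc_length [simp, measurable_cong]: "sets (arc_length n p) = sets borel"
  by (simp add: arc_length_def)

lemma space_arc_length [simp]: "space (arc_length n p) = UNIV"
  by (simp add: arc_length_def)

lemma arc_length_side_pos:
  assumes i: "i < n" and ne: "p i \<noteq> p (Suc i mod n)"
    and U: "open U" "side n p i t \<in> U" and t: "0 < t" "t < 1"
  shows "0 < emeasure (arc_length n p) (U \<inter> path_image (side n p i))"
proof -
  let ?I = "restrict_space lborel {0..1::real}"
  let ?M = "count_space {..<n} \<Otimes>\<^sub>M ?I"
  let ?f = "\<lambda>(i, t::real). ennreal (dist (p i) (p (Suc i mod n)))"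
  let ?A = "U \<inter> path_image (side n p i)"
  have cont: "continuous_on A (side n p j)" for A j
    unfolding side_def by (rule continuous_on_linepath)
  have side_meas: "(\<lambda>(i, t). side n p i t) \<in> measurable ?M borel"
  proof (rule measurable_pair_measure_countable1)
    fix j show "(\<lambda>t. case (j, t) of (i, t) \<Rightarrow> side n p i t) \<in> measurable ?I borel"
      using cont by (auto intro!: measurable_restrict_space1 borel_measurable_continuous_onI)
  qed auto
  have f_meas: "?f \<in> borel_measurable ?M"
    by (rule measurable_pair_measure_countable1) auto
  have A: "?A \<in> sets borel"
    using U compact_imp_closed[of "path_image (side n p i)"] by (simp add: side_def)
  \<comment> \<open>Endpoints are removed to make this parameter set open in the line;
    \<open>t\<close> shows that it is nonempty.\<close>
  define W where "W = {0<..<1} \<inter> side n p i -` U"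
  have W: "open W" "t \<in> W"
    unfolding W_def using U t cont by (auto intro!: open_Int open_vimage)
  have W_sub: "W \<subseteq> {0..1}" and W_sets: "W \<in> sets ?I"
    using W by (auto simp: W_def sets_restrict_space_iff)
  interpret I: sigma_finite_measure ?I
    by (rule sigma_finite_measure_restrict_space) (auto intro: lborel.sigma_finite_measure_axioms)
  let ?S = "(\<lambda>(i, t). side n p i t) -` ?A \<inter> space ?M"
  have S: "?S \<in> sets ?M"
    by (rule measurable_sets[OF side_meas A])
  have "W \<noteq> {}" using W by auto
  then have "0 < emeasure ?I W"
    using open_emeasure_lborel_pos[OF W(1)] W_sub by (subst emeasure_restrict_space) auto
  then have pos: "0 < emeasure ?M ({i} \<times> W)"
    using i W_sets by (subst I.emeasure_pair_measure_Times) auto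
  have iW: "{i} \<times> W \<in> sets ?M" using i W_sets by (intro pair_measureI) auto
  have "{i} \<times> W \<notin> null_sets (density ?M ?f)"
  proof
    assume "{i} \<times> W \<in> null_sets (density ?M ?f)"
    then have "AE z in ?M. z \<in> {i} \<times> W \<longrightarrow> ?f z = 0"
      using f_meas by (simp add: null_sets_density_iff)
    then have "AE z in ?M. z \<notin> {i} \<times> W"
      by (rule eventually_mono) (use ne in auto)
    then have "{i} \<times> W \<in> null_sets ?M" using iW by (simp add: AE_iff_null_sets)
    then show False using pos by auto
  qed
  then have "0 < emeasure (density ?M ?f) ({i} \<times> W)"
    using iW by (auto simp: null_sets_def zero_less_iff_neq_zero)
  also have "\<dots> \<le> emeasure (density ?M ?f) ?S"
    using i W_sub S by (intro emeasure_mono)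
      (auto simp: W_def space_pair_measure space_restrict_space path_image_def)
  finally show ?thesis
    unfolding arc_length_def using side_meas A
    by (subst emeasure_distr) auto
qed

section \<open>Measurability of the normal field and of the phase space\<close>

text \<open>The junk value \<open>0\<close> off the smooth boundary makes this globally measurable.\<close>

definition inward_normal :: "(real^2) set \<Rightarrow> real^2 \<Rightarrow> real^2" where
  "inward_normal B y = (if y \<in> smooth_boundary B then THE \<nu>. is_inward_normal B y \<nu> else 0)"

lemma inward_normal_eq: "is_inward_normal B y \<nu> \<Longrightarrow> inward_normal B y = \<nu>"
  by (simp add: inward_normal_def is_inward_normal_smooth the_inward_normal)

text \<open>In the ball where the table is a half plane, points off the bounding line are interior
  or exterior, so every frontier point there sees the same half plane. The normal is thus locally
  constant along the smooth boundary.\<close>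

lemma is_inward_normal_near:
  assumes "is_inward_normal B y \<nu>"
  obtains e where "0 < e" "\<And>z. z \<in> ball y e \<inter> frontier B \<Longrightarrow> is_inward_normal B z \<nu>"
proof -
  obtain e where e: "0 < e" "\<And>z. z \<in> ball y e \<Longrightarrow> z \<in> B \<longleftrightarrow> 0 \<le> (z - y) \<bullet> \<nu>"
    and n: "norm \<nu> = 1"
    using assms(1) by (auto simp: is_inward_normal_def)
  have "is_inward_normal B z \<nu>" if z: "z \<in> ball y e" "z \<in> frontier B" for z
  proof -
    have "(z - y) \<bullet> \<nu> = 0"
    proof (rule ccontr)
      assume ne: "(z - y) \<bullet> \<nu> \<noteq> 0"
      show False
      proof (cases "0 < (z - y) \<bullet> \<nu>")
        case True
        let ?U = "ball y e \<inter> {z. y \<bullet> \<nu> < z \<bullet> \<nu>}"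
        have "open ?U" by (intro open_Int open_ball open_Collect_less continuous_intros)
        moreover have "z \<in> ?U" using True z by (simp add: inner_diff_left)
        moreover have "?U \<subseteq> B" using e(2) by (force simp: inner_diff_left)
        ultimately have "z \<in> interior B" by (rule interiorI)
        then show False using z by (simp add: frontier_def)
      next
        case False
        let ?U = "ball y e \<inter> {z. z \<bullet> \<nu> < y \<bullet> \<nu>}"
        have "open ?U" by (intro open_Int open_ball open_Collect_less continuous_intros)
        moreover have "z \<in> ?U" using False ne z by (simp add: inner_diff_left)
        moreover have "?U \<inter> B = {}" using e(2) by (force simp: inner_diff_left)
        ultimately have "z \<notin> closure B" using open_Int_closure_eq_empty[of ?U B] by blast
        then show False using z by (simp add: frontier_def)
      qed
    qed
    then have "(x - y) \<bullet> \<nu> = (x - z) \<bullet> \<nu>" for x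
      by (simp add: inner_diff_left)
    moreover obtain d where "0 < d" "ball z d \<subseteq> ball y e"
      using z(1) by (meson open_ball open_contains_ball)
    ultimately have "0 < d \<and> (\<forall>x\<in>ball z d. x \<in> B \<longleftrightarrow> 0 \<le> (x - z) \<bullet> \<nu>)"
      using e(2) by (metis subsetD)
    then show ?thesis
      using n unfolding is_inward_normal_def by blast
  qed
  then show thesis using e(1) that by blast
qed

text \<open>Smooth points form a relatively open subset of the frontier; \<open>U\<close> is the
  union of the balls witnessing this.\<close>

lemma smooth_boundary_borel: "smooth_boundary B \<in> sets borel"
proof -
  define U where "U = \<Union>{ball y e | y e. \<forall>z \<in> ball y e \<inter> frontier B. z \<in> smooth_boundary B}"
  have "smooth_boundary B = frontier B \<inter> U"
  proof
    show "smooth_boundary B \<subseteq> frontier B \<inter> U"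
    proof
      fix y assume y: "y \<in> smooth_boundary B"
      then obtain \<nu> where "is_inward_normal B y \<nu>" by (auto simp: smooth_boundary_def)
      from is_inward_normal_near[OF this] obtain e where
        e: "0 < e" "\<And>z. z \<in> ball y e \<inter> frontier B \<Longrightarrow> is_inward_normal B z \<nu>" by blast
      have "y \<in> ball y e" using e(1) by simp
      moreover have "\<forall>z \<in> ball y e \<inter> frontier B. z \<in> smooth_boundary B"
        using e(2) is_inward_normal_smooth by blast
      ultimately have "y \<in> U" unfolding U_def by blast
      then show "y \<in> frontier B \<inter> U" using y by (auto simp: smooth_boundary_def)
    qed
  qed (auto simp: U_def)
  moreover have "open U" unfolding U_def by auto
  ultimately show ?thesis by (simp add: frontier_closed borel_closed)
qed

lemma inward_normal_measurable: "inward_normal B \<in> borel_measurable borel"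
  unfolding inward_normal_def
proof (rule borel_measurable_continuous_on_if[OF smooth_boundary_borel])
  show "continuous_on (smooth_boundary B) (\<lambda>y. THE \<nu>. is_inward_normal B y \<nu>)"
  proof (rule continuous_on_eq_continuous_within[THEN iffD2], rule ballI)
    fix y assume "y \<in> smooth_boundary B"
    then obtain \<nu> where \<nu>: "is_inward_normal B y \<nu>" by (auto simp: smooth_boundary_def)
    from is_inward_normal_near[OF this] obtain e where
      e: "0 < e" "\<And>z. z \<in> ball y e \<inter> frontier B \<Longrightarrow> is_inward_normal B z \<nu>" by blast
    show "continuous (at y within smooth_boundary B) (\<lambda>y. THE \<nu>. is_inward_normal B y \<nu>)"
    proof (rule continuous_transform_within[where \<delta> = e and f = "\<lambda>_. \<nu>"])
      fix z assume "z \<in> smooth_boundary B" "dist z y < e"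
      then show "\<nu> = (THE \<nu>. is_inward_normal B z \<nu>)"
        using e(2)[of z] the_inward_normal[of B z \<nu>] by (simp add: smooth_boundary_def dist_commute)
    qed (use e \<open>y \<in> smooth_boundary B\<close> in auto)
  qed
qed simp

lemma phase_space_eq:
  "phase_space L B = {((y, x), v). y \<in> smooth_boundary B \<and> x \<in> {0..<L} \<and> norm v = 1 \<and>
     0 < planar_part v \<bullet> inward_normal B y}"
proof -
  have "v \<bullet> e3 B (y, x) = planar_part v \<bullet> inward_normal B y" if "y \<in> smooth_boundary B" for v y x
    using that by (auto simp: smooth_boundary_def e3_eq inward_normal_eq inner_planar_vec)
  moreover have "smooth_boundary B \<subseteq> frontier B" by (auto simp: smooth_boundary_def)
  ultimately show ?thesis by (auto simp: phase_space_def boundary_M_def)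
qed

text \<open>The trap sets will be cut down to the phase space, and this keeps them invariant.
  Transversality of the next collision and the reversal of the normal velocity make the image point
  inward.\<close>

lemma billiard_map_phase_space:
  assumes "z \<in> billiard_domain L B" "0 < L"
  shows "billiard_map L \<beta> B z \<in> phase_space L B"
proof -
  obtain y x v where z: "z = ((y, x), v)" by (metis surj_pair)
  obtain y' x' where nx: "next_config L B (y, x) v = (y', x')" by (metis surj_pair)
  have D: "y' \<in> smooth_boundary B" "v \<bullet> e3 B (y', x') < 0" "norm v = 1"
    using assms(1) by (auto simp: z billiard_domain_def nx phase_space_def)
  then obtain \<nu> where \<nu>: "is_inward_normal B y' \<nu>" by (auto simp: smooth_boundary_def)
  have "x' \<in> {0..<L}"
    using nx assms(2) by (auto simp: next_config_def free_motion_def rmod_less rmod_nonneg)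
  moreover have "0 < planar_part (collision_map \<beta> B (y', x') v) \<bullet> inward_normal B y'"
    using D(2) by (simp add: collision_map_normal[OF \<nu>] inward_normal_eq[OF \<nu>] e3_eq[OF \<nu>] inner_planar_vec)
  ultimately show ?thesis
    using D norm_collision_map[OF \<nu>] by (simp add: z billiard_map_def nx phase_space_eq)
qed

section \<open>From the product measure to the billiard measure\<close>

context
  fixes L :: real and n :: nat and p :: "nat \<Rightarrow> real^2" and Q :: "(config \<times> (real^3)) measure"
  defines "Q \<equiv> boundary_area L n p \<Otimes>\<^sub>M sphere_area"
begin

lemma space_Q: "space Q = {((y, x), v). x \<in> {0..<L}}"
  by (auto simp: Q_def boundary_area_def space_pair_measure space_restrict_space)

lemma position_measurable: "(\<lambda>z. fst (fst z)) \<in> borel_measurable Q"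
proof -
  have "fst \<in> measurable (boundary_area L n p) (arc_length n p)"
    by (simp add: boundary_area_def)
  then have "fst \<in> borel_measurable (boundary_area L n p)"
    by (simp cong: measurable_cong_sets)
  then show ?thesis unfolding Q_def by (rule measurable_compose[OF measurable_fst])
qed

lemma velocity_measurable: "snd \<in> borel_measurable Q"
  using measurable_snd[of "boundary_area L n p" sphere_area]
  by (simp add: Q_def cong: measurable_cong_sets)

lemma planar_part_measurable: "(\<lambda>z. planar_part (snd z)) \<in> borel_measurable Q"
proof -
  have "planar_part \<in> borel_measurable borel"
    unfolding planar_part_def vector_2_eq
    by (intro borel_measurable_continuous_onI continuous_intros)
  then show ?thesis by (rule measurable_compose[OF velocity_measurable])
qed

lemma normal_component_measurable:
  "(\<lambda>z. planar_part (snd z) \<bullet> inward_normal B (fst (fst z))) \<in> borel_measurable Q"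
  by (intro borel_measurable_inner planar_part_measurable
      measurable_compose[OF position_measurable inward_normal_measurable])

lemma phase_space_sets: "phase_space L B \<in> sets Q"
proof -
  note [measurable] = position_measurable velocity_measurable normal_component_measurable smooth_boundary_borel
  have "{z \<in> space Q. fst (fst z) \<in> smooth_boundary B \<and> norm (snd z) = 1 \<and>
      0 < planar_part (snd z) \<bullet> inward_normal B (fst (fst z))} \<in> sets Q"
    by measurable
  also have "{z \<in> space Q. fst (fst z) \<in> smooth_boundary B \<and> norm (snd z) = 1 \<and>
      0 < planar_part (snd z) \<bullet> inward_normal B (fst (fst z))} = phase_space L B"
    by (auto simp: space_Q phase_space_eq)
  finally show ?thesis .
qed

lemma edge_trap_sets: "edge_trap P \<nu> \<mu> w \<eta> c1 c2 \<inter> space Q \<in> sets Q"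
proof -
  note [measurable] = position_measurable velocity_measurable planar_part_measurable
  have "{z \<in> space Q. (fst (fst z) - P) \<bullet> \<nu> = 0 \<and> 0 < (fst (fst z) - P) \<bullet> \<mu> \<and> norm (snd z - w) < \<eta> \<and>
     c1 < (fst (fst z) - P) \<bullet> \<mu> * (planar_part (snd z) \<bullet> \<nu>) \<and>
     (fst (fst z) - P) \<bullet> \<mu> * (planar_part (snd z) \<bullet> \<nu>) < c2} \<in> sets Q"
    by measurable
  also have "{z \<in> space Q. (fst (fst z) - P) \<bullet> \<nu> = 0 \<and> 0 < (fst (fst z) - P) \<bullet> \<mu> \<and> norm (snd z - w) < \<eta> \<and>
     c1 < (fst (fst z) - P) \<bullet> \<mu> * (planar_part (snd z) \<bullet> \<nu>) \<and>
     (fst (fst z) - P) \<bullet> \<mu> * (planar_part (snd z) \<bullet> \<nu>) < c2} = edge_trap P \<nu> \<mu> w \<eta> c1 c2 \<inter> space Q"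
    by (auto simp: edge_trap_def)
  finally show ?thesis .
qed

lemma sets_billiard_measure:
  "A \<in> sets (billiard_measure L n p) \<longleftrightarrow> A \<subseteq> phase_space L (polygon_region n p) \<and> A \<in> sets Q"
  unfolding billiard_measure_def sets_density Q_def[symmetric]
  using phase_space_sets sets.sets_into_space[OF phase_space_sets]
  by (subst sets_restrict_space_iff) (simp_all add: Int_absorb2)

text \<open>The density is strictly positive on the phase space, so passing to the billiard measure
  creates no new null sets there.\<close>

lemma emeasure_billiard_measure_eq_0:
  assumes "A \<in> sets (billiard_measure L n p)" "emeasure (billiard_measure L n p) A = 0"
  shows "emeasure Q A = 0"
proof -
  let ?B = "polygon_region n p"
  let ?N = "restrict_space Q (phase_space L ?B)"
  let ?f = "\<lambda>(q, v). ennreal (v \<bullet> e3 ?B q)"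
  have N: "billiard_measure L n p = density ?N ?f"
    by (simp add: billiard_measure_def Q_def)
  have ps: "phase_space L ?B \<inter> space Q \<in> sets Q"
    using phase_space_sets by blast
  have A: "A \<in> sets ?N" "A \<subseteq> phase_space L ?B"
    using assms(1) by (simp add: N) (use assms(1) in \<open>simp add: sets_billiard_measure\<close>)
  have "(\<lambda>z. ennreal (planar_part (snd z) \<bullet> inward_normal ?B (fst (fst z)))) \<in> borel_measurable ?N"
    by (intro measurable_restrict_space1 measurable_compose[OF _ measurable_ennreal]
        normal_component_measurable)
  moreover have f_eq: "?f z = ennreal (planar_part (snd z) \<bullet> inward_normal ?B (fst (fst z)))"
    if "z \<in> phase_space L ?B" for z
    using that by (auto simp: phase_space_def smooth_boundary_def e3_eq inward_normal_eq inner_planar_vec)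
  ultimately have f: "?f \<in> borel_measurable ?N"
    by (subst measurable_cong[where g = "\<lambda>z. ennreal (planar_part (snd z) \<bullet> inward_normal ?B (fst (fst z)))"])
      (auto simp: space_restrict_space)
  have "A \<in> null_sets (density ?N ?f)"
    using assms by (auto simp: null_sets_def N)
  then have "AE z in ?N. z \<in> A \<longrightarrow> ?f z = 0"
    using f by (simp add: null_sets_density_iff)
  moreover have "?f z \<noteq> 0" if "z \<in> A" for z
    using that A(2) by (auto simp: phase_space_def)
  ultimately have "AE z in ?N. z \<notin> A"
    by (auto elim: eventually_mono)
  then have "emeasure ?N A = 0"
    using A by (simp add: AE_iff_null_sets[symmetric] null_setsD1)
  then show ?thesis
    using ps A by (simp add: emeasure_restrict_space)
qed

lemma emeasure_Q_Times:
  assumes "Y \<in> sets borel" "V \<in> sets borel" "0 < L"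
  shows "emeasure Q ((Y \<times> {0..<L}) \<times> V) = emeasure (arc_length n p) Y * ennreal L * emeasure sphere_area V"
proof -
  interpret S: finite_measure sphere_area by (rule finite_measure_sphere_area)
  let ?I = "restrict_space lborel {0..<L}"
  interpret I: sigma_finite_measure ?I
    by (rule sigma_finite_measure_restrict_space) (auto intro: lborel.sigma_finite_measure_axioms)
  have I: "{0..<L} \<in> sets ?I" by (simp add: sets_restrict_space_iff)
  have "emeasure ?I {0..<L} = ennreal L" using assms by (subst emeasure_restrict_space) auto
  moreover have "Y \<times> {0..<L} \<in> sets (boundary_area L n p)"
    unfolding boundary_area_def using assms I by (intro pair_measureI) auto
  ultimately show ?thesis
    using assms I unfolding Q_def
    by (simp add: S.emeasure_pair_measure_Times) (simp add: boundary_area_def I.emeasure_pair_measure_Times)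
qed

lemma corner_trap_set_pos:
  assumes trap: "corner_trap (polygon_region n p) (p i) r (p (Suc i mod n) - p i) b \<nu> \<mu> L \<beta> h c2 w"
    and i: "i < n" and w: "norm w = 1"
    and c: "0 \<le> c1" "c1 < c2" "c2 \<le> h * ((p (Suc i mod n) - p i) \<bullet> \<mu>)"
  defines "A \<equiv> corner_trap_set (p i) \<nu> \<mu> w (h / 2) c1 c2 \<inter> phase_space L (polygon_region n p)"
  shows "A \<in> sets (billiard_measure L n p) \<and> emeasure (billiard_measure L n p) A \<noteq> 0"
proof -
  let ?B = "polygon_region n p"
  define P where "P = p i"
  define a where "a = p (Suc i mod n) - P"
  interpret corner_trap ?B P r a b \<nu> \<mu> L \<beta> h c2 w
    using trap by (simp add: P_def a_def)
  \<comment> \<open>A value inside the allowed range. Starting at \<open>P + t *\<^sub>R a\<close>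
    with velocity \<open>w\<close>, the product bounded in \<open>edge_trap\<close> equals
    \<open>c\<close>; the bound on \<open>c2\<close> keeps this point before the end of the
    edge.\<close>
  define c where "c = (c1 + c2) / 2"
  have c': "0 < c" "c1 < c" "c < c2" "c < h * (a \<bullet> \<mu>)"
    using assms by (auto simp: c_def a_def P_def)
  define t where "t = c / (h * (a \<bullet> \<mu>))"
  have ha: "0 < h * (a \<bullet> \<mu>)" using h_pos edge by simp
  have t: "0 < t" "t < 1" "t * (h * (a \<bullet> \<mu>)) = c"
    using c' ha h_pos edge by (simp_all add: t_def)
  have side: "side n p i s = P + s *\<^sub>R a" for s
    by (simp add: side_def linepath_def a_def P_def algebra_simps)
  \<comment> \<open>The defining conditions of the trap except for lying on the edge, which is not
    an open condition; intersecting with the side restores it.\<close>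
  let ?W = "{z :: (real^2) \<times> (real^3). 0 < (fst z - P) \<bullet> \<mu> \<and> norm (snd z - w) < h / 2 \<and>
     c1 < (fst z - P) \<bullet> \<mu> * (planar_part (snd z) \<bullet> \<nu>) \<and>
     (fst z - P) \<bullet> \<mu> * (planar_part (snd z) \<bullet> \<nu>) < c2}"
  have "open ?W"
    unfolding planar_part_def vector_2_eq
    by (intro open_Collect_conj open_Collect_less continuous_intros)
  moreover have "(P + t *\<^sub>R a, w) \<in> ?W"
    using t edge c' h_pos axis_normal by (simp add: algebra_simps)
  ultimately obtain U V where UV: "open U" "open V" "P + t *\<^sub>R a \<in> U" "w \<in> V" "U \<times> V \<subseteq> ?W"
    by (elim open_prod_elim) auto
  define Y where "Y = U \<inter> path_image (side n p i)"
  define S where "S = V \<inter> sphere 0 1"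
  have sub: "(Y \<times> {0..<L}) \<times> S \<subseteq> edge_trap P \<nu> \<mu> w (h / 2) c1 c2 \<inter> phase_space L ?B"
  proof clarify
    fix y x v assume y: "y \<in> Y" and x: "x \<in> {0..<L}" and v: "v \<in> S"
    have yP: "(y - P) \<bullet> \<nu> = 0" using y edge by (auto simp: Y_def path_image_def side)
    have "(y, v) \<in> ?W" using y v UV by (auto simp: Y_def S_def)
    then have yv: "0 < (y - P) \<bullet> \<mu>" "norm (v - w) < h / 2"
      "c1 < (y - P) \<bullet> \<mu> * (planar_part v \<bullet> \<nu>)" "(y - P) \<bullet> \<mu> * (planar_part v \<bullet> \<nu>) < c2"
      by auto
    have v\<nu>: "h / 2 < planar_part v \<bullet> \<nu>" using near_axis[OF yv(2)] by simp
    have nu: "is_inward_normal ?B y \<nu>"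
      using edge_trap_ball[OF yP yv(1) v\<nu> yv(4)] yP yv(1) inward_normal_edge by blast
    have "((y, x), v) \<in> phase_space L ?B"
      using is_inward_normal_smooth[OF nu] v\<nu> h_pos v x
      by (simp add: phase_space_eq inward_normal_eq[OF nu] S_def)
    then show "((y, x), v) \<in> edge_trap P \<nu> \<mu> w (h / 2) c1 c2 \<inter> phase_space L ?B"
      using yP yv by (simp add: edge_trap_def)
  qed
  have ps: "phase_space L ?B \<subseteq> space Q" using sets.sets_into_space[OF phase_space_sets] .
  have "A = (edge_trap P \<nu> \<mu> w (h / 2) c1 c2 \<inter> space Q \<union> edge_trap P \<mu> \<nu> (- w) (h / 2) c1 c2 \<inter> space Q)
      \<inter> phase_space L ?B"
    using ps by (auto simp: A_def corner_trap_set_def P_def)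
  then have AQ: "A \<in> sets Q"
    using edge_trap_sets phase_space_sets by (metis sets.Int sets.Un)
  then have A: "A \<in> sets (billiard_measure L n p)"
    by (auto simp: sets_billiard_measure A_def)
  have "a \<noteq> 0" using edge by auto
  then have "0 < emeasure (arc_length n p) Y"
    unfolding Y_def using i UV t
    by (intro arc_length_side_pos[of i n p U t]) (auto simp: side a_def P_def)
  moreover have "0 < emeasure sphere_area S"
    unfolding S_def using UV w by (intro sphere_area_open_pos)
  moreover have "Y \<in> sets borel" "S \<in> sets borel"
    using UV compact_imp_closed[of "path_image (side n p i)"] by (auto simp: Y_def S_def side_def)
  ultimately have "0 < emeasure Q ((Y \<times> {0..<L}) \<times> S)"
    using L_pos by (simp add: emeasure_Q_Times ennreal_zero_less_mult_iff)
  also have "\<dots> \<le> emeasure Q A"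
    using sub AQ by (intro emeasure_mono) (auto simp: A_def corner_trap_set_def P_def)
  finally have "emeasure Q A \<noteq> 0" by simp
  then show ?thesis using emeasure_billiard_measure_eq_0[OF A] A by blast
qed

end

section \<open>Two disjoint invariant sets\<close>

text \<open>Pieces at the same edge are separated by the value \<open>c2\<close>, which both ranges
  omit, and pieces at different edges by the position.\<close>

lemma corner_trap_set_disjoint:
  "corner_trap_set P \<nu> \<mu> w \<eta> c1 c2 \<inter> corner_trap_set P \<nu> \<mu> w \<eta> c2 c3 = {}"
  by (auto simp: corner_trap_set_def edge_trap_def)

theorem theorem7p1:
  fixes n :: nat and p :: "nat \<Rightarrow> real^2" and R \<gamma> \<beta> L :: real
  assumes "simple_polygon n p"
    and "R > 0"
    and "0 < \<gamma>" and "\<gamma> \<le> 1"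
    and "0 < \<beta>" and "\<beta> \<le> pi / 2"
    and "\<gamma> = tan (\<beta> / 2)"
    and "L = 2 * pi * \<gamma> * R"
  shows "\<not> ergodic (billiard_measure L n p)
             (billiard_domain L (polygon_region n p))
             (billiard_map L \<beta> (polygon_region n p))"
proof
  let ?B = "polygon_region n p" and ?M = "billiard_measure L n p"
  let ?D = "billiard_domain L ?B" and ?T = "billiard_map L \<beta> ?B"
  assume ergodic: "ergodic ?M ?D ?T"
  have L: "0 < L" using assms by simp
  have \<beta>: "cos \<beta> \<noteq> 1"
    using cos_monotone_0_pi[of 0 \<beta>] assms(5,6) pi_gt_zero by simp
  obtain i r b \<nu> \<mu> where i: "i < n" and
    "corner ?B (p i) r (p (Suc i mod n) - p i) b \<nu> \<mu>"
    using convex_corner[OF assms(1)] by blast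
  define P where "P = p i"
  define a where "a = p (Suc i mod n) - P"
  interpret corner ?B P r a b \<nu> \<mu>
    unfolding P_def a_def by fact
  define w where "w = corner_axis \<beta> \<nu> \<mu>"
  have "\<nu> \<noteq> \<mu>" using edge by auto
  then obtain h where h: "0 < h" "planar_part w \<bullet> \<nu> = h" "planar_part w \<bullet> \<mu> = - h"
    using corner_axis_normal[OF norm_normal] unfolding w_def by metis
  have w: "norm w = 1" using norm_corner_axis[OF \<open>\<nu> \<noteq> \<mu>\<close>] by (simp add: w_def)
  have w_swap: "corner_axis \<beta> \<mu> \<nu> = - w" unfolding w_def by (rule corner_axis_swap)
  have coll: "collision_map \<beta> ?B (y, x) w = - w" if "is_inward_normal ?B y \<nu>" for y x
    using collision_map_corner_axis[OF that \<beta>] by (simp add: w_def)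
  have coll': "collision_map \<beta> ?B (y, x) w = - w" if "is_inward_normal ?B y \<mu>" for y x
    using collision_map_corner_axis[OF that \<beta>, of x \<nu>] collision_map_uminus[OF that, of \<beta> x w]
    by (simp add: w_swap) (metis minus_minus)
  have ab: "0 < norm a" "0 < norm b" using edge by auto
  \<comment> \<open>The first bound leaves room on the edge for a starting point of positive-measure
    neighbourhoods; the other two are the condition \<open>small\<close> solved for the angular
    momentum.\<close>
  define c where "c = min (h * (a \<bullet> \<mu>))
    (min (r * h * (a \<bullet> \<mu>) / (2 * norm a)) (r * h * (b \<bullet> \<nu>) / (2 * norm b)))"
  have "0 < c" using h edge radius_pos ab by (simp add: c_def)
  have trap: "corner_trap ?B P r a b \<nu> \<mu> L \<beta> h k w" if "k \<le> c" for k
  proof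
    have "k \<le> r * h * (a \<bullet> \<mu>) / (2 * norm a)" "k \<le> r * h * (b \<bullet> \<nu>) / (2 * norm b)"
      using that by (auto simp: c_def)
    then show "2 * k * norm a \<le> r * h * (a \<bullet> \<mu>)" "2 * k * norm b \<le> r * h * (b \<bullet> \<nu>)"
      using ab by (simp_all add: field_simps)
  qed (use L h coll coll' in auto)
  define A where "A = (\<lambda>c1 c2. corner_trap_set P \<nu> \<mu> w (h / 2) c1 c2 \<inter> phase_space L ?B)"
  have A: "A c1 c2 \<in> sets ?M" "emeasure ?M (A c1 c2) \<noteq> 0" if "0 \<le> c1" "c1 < c2" "c2 \<le> c" for c1 c2
    using corner_trap_set_pos[OF trap[OF that(3), unfolded P_def a_def] i w that(1,2)] that(3) i
    by (auto simp: A_def P_def a_def c_def)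
  have inv: "?T -` A c1 c2 \<inter> ?D = A c1 c2 \<inter> ?D" if "c2 \<le> c" for c1 c2
  proof -
    interpret corner_trap ?B P r a b \<nu> \<mu> L \<beta> h c2 w by (rule trap[OF that])
    have "?D \<subseteq> phase_space L ?B" by (auto simp: billiard_domain_def)
    then show ?thesis
      using corner_trap_set_invariant[of c1] billiard_map_phase_space[OF _ L, of _ ?B \<beta>]
      unfolding A_def by blast
  qed
  \<comment> \<open>Splitting the range at \<open>c / 2\<close> puts the second invariant set into
    the complement of the first, so neither alternative of ergodicity can hold.\<close>
  have "emeasure ?M (A 0 (c / 2)) = 0 \<or> emeasure ?M (space ?M - A 0 (c / 2)) = 0"
    using ergodic A(1)[of 0 "c / 2"] inv[of "c / 2" 0] \<open>0 < c\<close> unfolding ergodic_def by simp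
  moreover have "emeasure ?M (A (c / 2) c) \<le> emeasure ?M (space ?M - A 0 (c / 2))"
  proof (rule emeasure_mono)
    show "A (c / 2) c \<subseteq> space ?M - A 0 (c / 2)"
      using corner_trap_set_disjoint[of P \<nu> \<mu> w "h / 2" 0 "c / 2" c]
        sets.sets_into_space[OF A(1)[of "c / 2" c]] \<open>0 < c\<close>
      by (auto simp: A_def)
    show "space ?M - A 0 (c / 2) \<in> sets ?M"
      using A(1)[of 0 "c / 2"] \<open>0 < c\<close> by (intro sets.compl_sets) simp
  qed
  ultimately show False
    using A(2)[of 0 "c / 2"] A(2)[of "c / 2" c] \<open>0 < c\<close> by simp
qed

end
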